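(* Let $n\geq 2$, $1\leq p\leq\infty$, $0<s<1$ with $sp<n$, $p^*_s:=\frac{np}{n-sp}$, and $1\leq r<\min\{p^*_s,q\}\leq\max\{p^*_s,q\}<\infty$. Let $K,V:\mathbf{R}^n\to\mathbf{R}$ be two positive Lebesgue measurable functions such that $\inf_{\mathbf{D}}V>0$ for every compact subset $\mathbf{D}\subset\mathbf{R}^n$, such that $K\in L^t_{loc}(\mathbf{R}^n)$ for some $t\in\bigl(\frac{\max\{p^*_s,q\}}{\max\{p^*_s,q\}-r},\infty\bigr]$, and such that $K^{\psi_{p^*_s}(\tau)}V^{-\tau}\in L^1(\mathbf{R}^n)$ for some $\tau\in\bigl[0,\frac{r}{q-r}\bigr]$, where $\psi_{p^*_s}(\tau):=\frac{p^*_s+\tau(p^*_s-q)}{p^*_s-r}$. Then the embedding $M^{s;q,p}_{\mathrm V}(\mathbf{R}^n)\to L^r_{\mathrm K}(\mathbf{R}^n)$ is compact.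
   Context: When $sp<n$, $M^{s;q,p}_{\mathrm V}(\mathbf{R}^n)$ is the Banach space obtained as the completion of (the functions of finite norm in) $C^1_c(\mathbf{R}^n)$ with respect to the norm $$\|u\|_{M^{s;q,p}_{\mathrm V}(\mathbf{R}^n)}:=\Bigl(\int_{\mathbf{R}^n}|u|^qV\,dx\Bigr)^{1/q}+[u]_{s,p,\mathbf{R}^n},\qquad [u]^p_{s,p,\mathbf{R}^n}:=\int_{\mathbf{R}^n}\int_{\mathbf{R}^n}\frac{|u(x)-u(y)|^p}{|x-y|^{n+sp}}\,dx\,dy;$$ it is a subspace of $D^{s,p}(\mathbf{R}^n)$, the completion of $C^1_c(\mathbf{R}^n)$ with respect to $[\cdot]_{s,p,\mathbf{R}^n}$. $L^r_{\mathrm K}(\mathbf{R}^n)$ is the weighted Lebesgue space with norm $\bigl(\int_{\mathbf{R}^n}|u|^rK\,dx\bigr)^{1/r}$. *)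

theory Defs
  imports "HOL-Analysis.Analysis"
begin

section \<open>Weighted Lebesgue spaces\<close>

text \<open>
  All functions are real-valued and elements of the function spaces are represented by measurable
  functions rather than by classes modulo almost-everywhere equality. Each space is closed under
  almost-everywhere equality, and its norm depends only on the class.
\<close>

definition pow_integral :: "'a measure \<Rightarrow> ('a \<Rightarrow> real) \<Rightarrow> real \<Rightarrow> ('a \<Rightarrow> real) \<Rightarrow> ennreal" where
  "pow_integral M W r f = (\<integral>\<^sup>+x. ennreal (\<bar>f x\<bar> powr r * W x) \<partial>M)"

definition Lw_norm :: "real \<Rightarrow> ('a::euclidean_space \<Rightarrow> real) \<Rightarrow> ('a \<Rightarrow> real) \<Rightarrow> real" where
  "Lw_norm r W u = enn2real (pow_integral lebesgue W r u) powr (1 / r)"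

definition Lw :: "real \<Rightarrow> ('a::euclidean_space \<Rightarrow> real) \<Rightarrow> ('a \<Rightarrow> real) set" where
  "Lw r W = {u \<in> borel_measurable lebesgue. pow_integral lebesgue W r u < \<infinity>}"

definition L_loc :: "ereal \<Rightarrow> ('a::euclidean_space \<Rightarrow> real) set" where
  "L_loc t = {f \<in> borel_measurable lebesgue. \<forall>D. compact D \<longrightarrow>
     (if t = \<infinity> then \<exists>C. AE x in lebesgue. x \<in> D \<longrightarrow> \<bar>f x\<bar> \<le> C
      else (\<integral>\<^sup>+x\<in>D. ennreal (\<bar>f x\<bar> powr real_of_ereal t) \<partial>lebesgue) < \<infinity>)}"


section \<open>Fractional Sobolev seminorm and the weighted space\<close>

definition C1c :: "('a::euclidean_space \<Rightarrow> real) set" where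
  "C1c = {u. (\<exists>u' :: 'a \<Rightarrow> 'a \<Rightarrow>\<^sub>L real.
               (\<forall>x. (u has_derivative blinfun_apply (u' x)) (at x)) \<and> continuous_on UNIV u') \<and>
             compact (closure {x. u x \<noteq> 0})}"

definition gagliardo_integral :: "real \<Rightarrow> real \<Rightarrow> ('a::euclidean_space \<Rightarrow> real) \<Rightarrow> ennreal" where
  "gagliardo_integral s p u =
     (\<integral>\<^sup>+x. (\<integral>\<^sup>+y. ennreal (\<bar>u x - u y\<bar> powr p / norm (x - y) powr (real DIM('a) + s * p))
        \<partial>lebesgue) \<partial>lebesgue)"

definition gagliardo_seminorm :: "real \<Rightarrow> real \<Rightarrow> ('a::euclidean_space \<Rightarrow> real) \<Rightarrow> real" where
  "gagliardo_seminorm s p u = enn2real (gagliardo_integral s p u) powr (1 / p)"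

definition MV_norm :: "real \<Rightarrow> real \<Rightarrow> real \<Rightarrow> ('a::euclidean_space \<Rightarrow> real) \<Rightarrow> ('a \<Rightarrow> real) \<Rightarrow> real" where
  "MV_norm s q p V u = Lw_norm q V u + gagliardo_seminorm s p u"

text \<open>The Lebesgue measurable functions whose norm is finite.\<close>

definition MV_fin :: "real \<Rightarrow> real \<Rightarrow> real \<Rightarrow> ('a::euclidean_space \<Rightarrow> real) \<Rightarrow> ('a \<Rightarrow> real) set" where
  "MV_fin s q p V = {u \<in> Lw q V. gagliardo_integral s p u < \<infinity>}"

text \<open>
  The completion of the finite-norm functions in \<^const>\<open>C1c\<close>, realised as a space of functions.
  That this is a completion (complete, and containing these functions isometrically and densely)
  is proved below in \<open>MV_space_complete\<close>, \<open>C1c_subset_MV_space\<close> and \<open>MV_space_dense\<close>. It is a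
  vector space (\<open>MV_space_add\<close>, \<open>MV_space_scale\<close>), and its norm vanishes exactly on the functions
  that are zero almost everywhere (\<open>MV_norm_eq_0_iff\<close>).
\<close>

definition MV_space :: "real \<Rightarrow> real \<Rightarrow> real \<Rightarrow> ('a::euclidean_space \<Rightarrow> real) \<Rightarrow> ('a \<Rightarrow> real) set" where
  "MV_space s q p V = {u \<in> MV_fin s q p V. \<exists>U :: nat \<Rightarrow> 'a \<Rightarrow> real.
     (\<forall>k. U k \<in> C1c \<inter> MV_fin s q p V) \<and> (\<lambda>k. MV_norm s q p V (\<lambda>x. U k x - u x)) \<longlonglongrightarrow> 0}"


section \<open>Exponents and compact embeddings\<close>

definition crit_exp :: "nat \<Rightarrow> real \<Rightarrow> real \<Rightarrow> real" where
  "crit_exp n s p = real n * p / (real n - s * p)"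

definition psi :: "real \<Rightarrow> real \<Rightarrow> real \<Rightarrow> real \<Rightarrow> real" where
  "psi P q r \<tau> = (P + \<tau> * (P - q)) / (P - r)"

text \<open>
  The inclusion of \<open>X\<close> (norm \<open>NX\<close>) into \<open>Y\<close> (norm \<open>NY\<close>) is well defined, bounded and maps bounded
  sequences to sequences with a convergent subsequence.
\<close>

definition compact_embedding ::
  "('a \<Rightarrow> real) set \<Rightarrow> (('a \<Rightarrow> real) \<Rightarrow> real) \<Rightarrow> ('a \<Rightarrow> real) set \<Rightarrow> (('a \<Rightarrow> real) \<Rightarrow> real) \<Rightarrow> bool" where
  "compact_embedding X NX Y NY \<longleftrightarrow>
     X \<subseteq> Y \<and> (\<exists>C. \<forall>u\<in>X. NY u \<le> C * NX u) \<and>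
     (\<forall>U :: nat \<Rightarrow> 'a \<Rightarrow> real. (\<forall>k. U k \<in> X) \<and> bounded (range (\<lambda>k. NX (U k))) \<longrightarrow>
        (\<exists>\<phi> :: nat \<Rightarrow> nat. \<exists>v\<in>Y. strict_mono \<phi> \<and> (\<lambda>k. NY (\<lambda>x. U (\<phi> k) x - v x)) \<longlonglongrightarrow> 0))"


section \<open>Minkowski's inequality\<close>

lemma powr_add_le_convex:
  fixes a b A B p :: real
  assumes p: "p \<ge> 1" and A: "A > 0" and B: "B > 0"
  shows "\<bar>a + b\<bar> powr p \<le> (A + B) powr (p - 1) * (A powr (1 - p) * \<bar>a\<bar> powr p + B powr (1 - p) * \<bar>b\<bar> powr p)"
proof -
  have conv: "convex_on {0..} (\<lambda>x::real. x powr p)"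
  proof (intro convex_onI)
    fix t x y :: real assume t: "0 < t" "t < 1" and xy: "x \<in> {0..}" "y \<in> {0..}"
    have tp: "t powr p \<le> t" if "0 < t" "t < 1" for t :: real
      using powr_mono'[of 1 p t] that p by simp
    show "((1 - t) *\<^sub>R x + t *\<^sub>R y) powr p \<le> (1 - t) * x powr p + t * y powr p"
    proof (cases "x = 0 \<or> y = 0")
      case True
      then show ?thesis
        using mult_right_mono[OF tp[of t], of "y powr p"] mult_right_mono[OF tp[of "1 - t"], of "x powr p"]
          t xy p
        by (auto simp: powr_mult)
    next
      case False
      then show ?thesis
        using convex_onD[OF powr_convex[OF p], of t x y] t xy by auto
    qed
  qed (simp add: convex_real_interval)
  have "\<bar>a + b\<bar> powr p \<le> (\<bar>a\<bar> + \<bar>b\<bar>) powr p"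
    using p by (intro powr_mono2) auto
  also have "\<bar>a\<bar> + \<bar>b\<bar> = (A + B) * ((1 - B / (A + B)) * (\<bar>a\<bar> / A) + B / (A + B) * (\<bar>b\<bar> / B))"
  proof -
    have "1 - B / (A + B) = A / (A + B)" using A B by (simp add: field_simps)
    then show ?thesis using A B by (simp add: distrib_left)
  qed
  also have "\<dots> powr p = (A + B) powr p * ((1 - B / (A + B)) * (\<bar>a\<bar> / A) + B / (A + B) * (\<bar>b\<bar> / B)) powr p"
    using A B by (intro powr_mult)
  also have "\<dots> \<le> (A + B) powr p * ((1 - B / (A + B)) * (\<bar>a\<bar> / A) powr p + B / (A + B) * (\<bar>b\<bar> / B) powr p)"
    using convex_onD[OF conv, of "B / (A + B)" "\<bar>a\<bar> / A" "\<bar>b\<bar> / B"] A B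
    by (intro mult_left_mono) auto
  also have "\<dots> = (A + B) powr (p - 1) * (A powr (1 - p) * \<bar>a\<bar> powr p + B powr (1 - p) * \<bar>b\<bar> powr p)"
  proof -
    have "1 - B / (A + B) = A / (A + B)" using A B by (simp add: field_simps)
    moreover have "(A + B) powr p = (A + B) powr (p - 1) * (A + B)"
      using A B by (simp add: powr_diff)
    moreover have "A powr (1 - p) = A / A powr p" "B powr (1 - p) = B / B powr p"
      using A B by (simp_all add: powr_diff)
    moreover have "(R * S) * (A / S * (x / A') + B / S * (y / B')) = R * (A / A' * x + B / B' * y)"
      if "S \<noteq> 0" for R S x y A' B' :: real
      using that by (simp add: distrib_left)
    ultimately show ?thesis
      using A B by (simp only: powr_divide)
  qed
  finally show ?thesis .
qed

lemma pow_integral_cmult: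
  assumes [measurable]: "f \<in> borel_measurable M" "W \<in> borel_measurable M"
    and "\<And>x. W x \<ge> 0" "c \<ge> 0"
  shows "(\<integral>\<^sup>+x. ennreal (c * (\<bar>f x\<bar> powr p * W x)) \<partial>M) = ennreal c * pow_integral M W p f"
  using assms unfolding pow_integral_def by (simp add: nn_integral_cmult ennreal_mult)

lemma enn2real_powr_le_iff:
  assumes "x < \<infinity>" "p > 0" "A \<ge> 0"
  shows "enn2real x powr (1 / p) \<le> A \<longleftrightarrow> x \<le> ennreal (A powr p)"
proof -
  obtain y where y: "y \<ge> 0" "x = ennreal y"
    using assms by (cases x) auto
  have "y powr (1 / p) \<le> A \<longleftrightarrow> (y powr (1 / p)) powr p \<le> A powr p"
  proof
    show "(y powr (1 / p)) powr p \<le> A powr p" if "y powr (1 / p) \<le> A"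
      using assms that by (intro powr_mono2) auto
    show "y powr (1 / p) \<le> A" if "(y powr (1 / p)) powr p \<le> A powr p"
      using that powr_less_mono2[OF assms(2,3), of "y powr (1 / p)"] by linarith
  qed
  also have "(y powr (1 / p)) powr p = y"
    using assms y by (simp add: powr_powr)
  finally show ?thesis using y by simp
qed

lemma pow_integral_add_le:
  assumes [measurable]: "f \<in> borel_measurable M" "g \<in> borel_measurable M" "W \<in> borel_measurable M"
    and W: "\<And>x. W x \<ge> 0" and p: "p \<ge> 1" and A: "A > 0" and B: "B > 0"
  shows "pow_integral M W p (\<lambda>x. f x + g x) \<le>
    ennreal ((A + B) powr (p - 1) * A powr (1 - p)) * pow_integral M W p f +
    ennreal ((A + B) powr (p - 1) * B powr (1 - p)) * pow_integral M W p g"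
proof -
  have "pow_integral M W p (\<lambda>x. f x + g x) \<le>
    (\<integral>\<^sup>+x. ennreal ((A + B) powr (p - 1) * A powr (1 - p) * (\<bar>f x\<bar> powr p * W x)) +
           ennreal ((A + B) powr (p - 1) * B powr (1 - p) * (\<bar>g x\<bar> powr p * W x)) \<partial>M)"
    unfolding pow_integral_def
  proof (intro nn_integral_mono)
    fix x
    show "ennreal (\<bar>f x + g x\<bar> powr p * W x)
         \<le> ennreal ((A + B) powr (p - 1) * A powr (1 - p) * (\<bar>f x\<bar> powr p * W x)) +
           ennreal ((A + B) powr (p - 1) * B powr (1 - p) * (\<bar>g x\<bar> powr p * W x))"
    proof (subst ennreal_plus[symmetric])
      show "ennreal (\<bar>f x + g x\<bar> powr p * W x)
         \<le> ennreal ((A + B) powr (p - 1) * A powr (1 - p) * (\<bar>f x\<bar> powr p * W x) +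
           (A + B) powr (p - 1) * B powr (1 - p) * (\<bar>g x\<bar> powr p * W x))"
        using mult_right_mono[OF powr_add_le_convex[OF p A B, of "f x" "g x"] W[of x]]
        by (intro ennreal_leI) (simp only: algebra_simps)
    qed (use W in auto)
  qed
  also have "\<dots> = ennreal ((A + B) powr (p - 1) * A powr (1 - p)) * pow_integral M W p f +
    ennreal ((A + B) powr (p - 1) * B powr (1 - p)) * pow_integral M W p g"
    using W by (subst nn_integral_add) (simp_all add: pow_integral_cmult)
  finally show ?thesis .
qed

lemma pow_integral_add_finite:
  assumes "f \<in> borel_measurable M" "g \<in> borel_measurable M" "W \<in> borel_measurable M"
    and "\<And>x. W x \<ge> 0" and "p \<ge> 1"
    and "pow_integral M W p f < \<infinity>" "pow_integral M W p g < \<infinity>"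
  shows "pow_integral M W p (\<lambda>x. f x + g x) < \<infinity>"
  using pow_integral_add_le[OF assms(1-5), of 1 1] assms(6,7)
  by (auto simp: ennreal_mult_less_top intro: le_less_trans)

lemma Minkowski:
  assumes "f \<in> borel_measurable M" "g \<in> borel_measurable M" "W \<in> borel_measurable M"
    and "\<And>x. W x \<ge> 0" and p: "p \<ge> 1"
    and fin: "pow_integral M W p f < \<infinity>" "pow_integral M W p g < \<infinity>"
  shows "enn2real (pow_integral M W p (\<lambda>x. f x + g x)) powr (1 / p) \<le>
    enn2real (pow_integral M W p f) powr (1 / p) + enn2real (pow_integral M W p g) powr (1 / p)"
    (is "?l \<le> ?a + ?b")
proof (rule field_le_epsilon)
  fix e :: real assume e: "e > 0"
  define A where "A = ?a + e / 2"
  define B where "B = ?b + e / 2"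
  have AB: "A > 0" "B > 0" using e by (auto simp: A_def B_def add_nonneg_pos)
  have a: "pow_integral M W p f \<le> ennreal (A powr p)"
    using enn2real_powr_le_iff[OF fin(1), of p A] p AB e by (auto simp: A_def)
  have b: "pow_integral M W p g \<le> ennreal (B powr p)"
    using enn2real_powr_le_iff[OF fin(2), of p B] p AB e by (auto simp: B_def)
  have "pow_integral M W p (\<lambda>x. f x + g x) \<le>
    ennreal ((A + B) powr (p - 1) * A powr (1 - p)) * ennreal (A powr p) +
    ennreal ((A + B) powr (p - 1) * B powr (1 - p)) * ennreal (B powr p)"
    by (rule order_trans[OF pow_integral_add_le[OF assms(1-5) AB]])
       (intro add_mono mult_left_mono a b; simp)
  also have "\<dots> = ennreal ((A + B) powr (p - 1) * (A powr (1 - p) * A powr p + B powr (1 - p) * B powr p))"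
    by (simp add: ennreal_mult[symmetric] ennreal_plus[symmetric] distrib_left mult.assoc del: ennreal_plus)
  also have "A powr (1 - p) * A powr p = A" using AB by (simp add: powr_add[symmetric])
  also have "B powr (1 - p) * B powr p = B" using AB by (simp add: powr_add[symmetric])
  also have "(A + B) powr (p - 1) * (A + B) = (A + B) powr p"
    using AB by (simp add: powr_diff)
  finally have "?l \<le> A + B"
    using enn2real_powr_le_iff[OF pow_integral_add_finite[OF assms], of p "A + B"] p AB by simp
  then show "?l \<le> ?a + ?b + e" by (simp add: A_def B_def)
qed

lemma pow_integral_scale:
  assumes "f \<in> borel_measurable M" "W \<in> borel_measurable M" "\<And>x. W x \<ge> 0"
  shows "pow_integral M W r (\<lambda>x. c * f x) = ennreal (\<bar>c\<bar> powr r) * pow_integral M W r f"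
  using pow_integral_cmult[OF assms, of "\<bar>c\<bar> powr r" r]
  by (simp add: pow_integral_def abs_mult powr_mult mult.assoc)

lemma pow_integral_Fatou:
  assumes [measurable]: "f \<in> borel_measurable M" "\<And>j. F j \<in> borel_measurable M" "W \<in> borel_measurable M"
    and ae: "AE x in M. (\<lambda>j::nat. F j x) \<longlonglongrightarrow> g x" and r: "r > 0"
    and ev: "\<forall>\<^sub>F j in sequentially. pow_integral M W r (\<lambda>x. f x - F j x) \<le> C"
  shows "pow_integral M W r (\<lambda>x. f x - g x) \<le> C"
proof -
  have "pow_integral M W r (\<lambda>x. f x - g x) =
    (\<integral>\<^sup>+x. liminf (\<lambda>j. ennreal (\<bar>f x - F j x\<bar> powr r * W x)) \<partial>M)"
    unfolding pow_integral_def
  proof (intro nn_integral_cong_AE, use ae in eventually_elim)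
    case (elim x)
    have "(\<lambda>j. ennreal (\<bar>f x - F j x\<bar> powr r * W x)) \<longlonglongrightarrow> ennreal (\<bar>f x - g x\<bar> powr r * W x)"
      using r by (intro tendsto_ennrealI tendsto_mult tendsto_powr' tendsto_rabs tendsto_diff elim tendsto_const) auto
    then show ?case by (simp add: lim_imp_Liminf)
  qed
  also have "\<dots> \<le> liminf (\<lambda>j. pow_integral M W r (\<lambda>x. f x - F j x))"
    unfolding pow_integral_def by (intro nn_integral_liminf) measurable
  also have "\<dots> \<le> liminf (\<lambda>j::nat. C)"
    by (rule Liminf_mono[OF ev])
  also have "\<dots> = C" by (simp add: Liminf_const)
  finally show ?thesis .
qed

lemma pow_integral_minus:
  "pow_integral M W p (\<lambda>x. - f x) = pow_integral M W p f"
  by (simp add: pow_integral_def)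

lemma pow_integral_minus_commute:
  "pow_integral M W p (\<lambda>x. f x - g x) = pow_integral M W p (\<lambda>x. g x - f x)"
  by (simp add: pow_integral_def abs_minus_commute)


section \<open>The Gagliardo integral as a weighted integral on the product space\<close>

lemma sigma_finite_lebesgue: "sigma_finite_measure (lebesgue :: 'a::euclidean_space measure)"
proof
  obtain A :: "'a set set" where "countable A" "A \<subseteq> sets lborel" "\<Union>A = space lborel"
    "\<forall>a\<in>A. emeasure lborel a \<noteq> \<infinity>"
    using lborel.sigma_finite_countable by blast
  then show "\<exists>A::'a set set. countable A \<and> A \<subseteq> sets lebesgue \<and> \<Union>A = space lebesgue \<and>
     (\<forall>a\<in>A. emeasure lebesgue a \<noteq> \<infinity>)"
    by (intro exI[of _ A]) (auto simp: subset_iff)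
qed

definition gker :: "real \<Rightarrow> real \<Rightarrow> 'a::euclidean_space \<times> 'a \<Rightarrow> real" where
  "gker s p z = 1 / norm (fst z - snd z) powr (real DIM('a) + s * p)"

definition gdiff :: "('a \<Rightarrow> real) \<Rightarrow> 'a \<times> 'a \<Rightarrow> real" where
  "gdiff u z = u (fst z) - u (snd z)"

lemma gker_nonneg: "gker s p z \<ge> 0"
  by (simp add: gker_def)

lemma gker_measurable [measurable]:
  "(gker s p :: 'a::euclidean_space \<times> 'a \<Rightarrow> real) \<in> borel_measurable (lebesgue \<Otimes>\<^sub>M lebesgue)"
proof -
  have id [measurable]: "(\<lambda>x::'a. x) \<in> borel_measurable lebesgue"
    by (intro measurable_completion) simp
  have [measurable]: "(\<lambda>z::'a \<times> 'a. fst z) \<in> borel_measurable (lebesgue \<Otimes>\<^sub>M lebesgue)"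
    "(\<lambda>z::'a \<times> 'a. snd z) \<in> borel_measurable (lebesgue \<Otimes>\<^sub>M lebesgue)"
    using measurable_compose[OF measurable_fst id] measurable_compose[OF measurable_snd id] by auto
  show ?thesis unfolding gker_def by measurable
qed

lemma gdiff_measurable [measurable]:
  fixes u :: "'a::euclidean_space \<Rightarrow> real"
  assumes "u \<in> borel_measurable lebesgue"
  shows "gdiff u \<in> borel_measurable (lebesgue \<Otimes>\<^sub>M lebesgue)"
proof -
  have [measurable]: "(\<lambda>z::'a \<times> 'a. u (fst z)) \<in> borel_measurable (lebesgue \<Otimes>\<^sub>M lebesgue)"
    "(\<lambda>z::'a \<times> 'a. u (snd z)) \<in> borel_measurable (lebesgue \<Otimes>\<^sub>M lebesgue)"
    using measurable_compose[OF measurable_fst assms] measurable_compose[OF measurable_snd assms] by auto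
  show ?thesis unfolding gdiff_def by measurable
qed

lemma gagliardo_integral_eq:
  fixes u :: "'a::euclidean_space \<Rightarrow> real"
  assumes [measurable]: "u \<in> borel_measurable lebesgue"
  shows "gagliardo_integral s p u = pow_integral (lebesgue \<Otimes>\<^sub>M lebesgue) (gker s p) p (gdiff u)"
proof -
  interpret sigma_finite_measure "lebesgue :: 'a measure" by (rule sigma_finite_lebesgue)
  have "pow_integral (lebesgue \<Otimes>\<^sub>M lebesgue) (gker s p) p (gdiff u) =
    (\<integral>\<^sup>+x. \<integral>\<^sup>+y. ennreal (\<bar>gdiff u (x, y)\<bar> powr p * gker s p (x, y)) \<partial>lebesgue \<partial>lebesgue)"
    unfolding pow_integral_def by (rule nn_integral_fst[symmetric]) measurable
  then show ?thesis
    unfolding gagliardo_integral_def by (simp add: gker_def gdiff_def)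
qed

lemma gdiff_add: "gdiff (\<lambda>x. u x + v x) = (\<lambda>z. gdiff u z + gdiff v z)"
  and gdiff_diff: "gdiff (\<lambda>x. u x - v x) = (\<lambda>z. gdiff u z - gdiff v z)"
  by (auto simp: gdiff_def fun_eq_iff)

lemma gdiff_minus: "gdiff (\<lambda>x. - u x) = (\<lambda>z. - gdiff u z)"
  by (auto simp: gdiff_def fun_eq_iff)


section \<open>The weighted space is the completion\<close>

lemma C1c_add:
  assumes "u \<in> C1c" "v \<in> C1c"
  shows "(\<lambda>x. u x + v x) \<in> C1c"
proof -
  obtain u' v' where d: "\<And>x. (u has_derivative blinfun_apply (u' x)) (at x)" "continuous_on UNIV u'"
    "\<And>x. (v has_derivative blinfun_apply (v' x)) (at x)" "continuous_on UNIV v'"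
    and c: "compact (closure {x. u x \<noteq> 0})" "compact (closure {x. v x \<noteq> 0})"
    using assms unfolding C1c_def by blast
  have "closure {x. u x + v x \<noteq> 0} \<subseteq> closure {x. u x \<noteq> 0} \<union> closure {x. v x \<noteq> 0}"
    unfolding closure_Un[symmetric] by (rule closure_mono) auto
  then have "compact (closure {x. u x + v x \<noteq> 0})"
    using compact_Int_closed[OF compact_Un[OF c] closed_closure, of "{x. u x + v x \<noteq> 0}"]
    by (simp add: Int_absorb1)
  moreover have "((\<lambda>x. u x + v x) has_derivative blinfun_apply (u' x + v' x)) (at x)" for x
    using has_derivative_add[OF d(1,3)] by (simp add: plus_blinfun.rep_eq)
  moreover have "continuous_on UNIV (\<lambda>x. u' x + v' x)"
    using d by (intro continuous_on_add)
  ultimately show ?thesis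
    unfolding C1c_def by (auto intro!: exI[of _ "\<lambda>x. u' x + v' x"])
qed

lemma C1c_scale:
  assumes "u \<in> C1c"
  shows "(\<lambda>x. c * u x) \<in> C1c"
proof -
  obtain u' where d: "\<And>x. (u has_derivative blinfun_apply (u' x)) (at x)" "continuous_on UNIV u'"
    and c: "compact (closure {x. u x \<noteq> 0})"
    using assms unfolding C1c_def by blast
  have "closure {x. c * u x \<noteq> 0} \<subseteq> closure {x. u x \<noteq> 0}"
    by (rule closure_mono) auto
  then have "compact (closure {x. c * u x \<noteq> 0})"
    using compact_Int_closed[OF c closed_closure, of "{x. c * u x \<noteq> 0}"]
    by (simp only: Int_absorb1)
  moreover have "((\<lambda>x. c * u x) has_derivative blinfun_apply (c *\<^sub>R u' x)) (at x)" for x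
    using has_derivative_mult_right[OF d(1), of c x] by (simp add: scaleR_blinfun.rep_eq)
  moreover have "continuous_on UNIV (\<lambda>x. c *\<^sub>R u' x)"
    using d by (intro continuous_intros)
  ultimately show ?thesis
    unfolding C1c_def by (auto intro!: exI[of _ "\<lambda>x. c *\<^sub>R u' x"])
qed

context
  fixes s p q :: real and V :: "'a::euclidean_space \<Rightarrow> real"
  assumes p: "1 \<le> p" and q: "1 \<le> q"
    and V_meas: "V \<in> borel_measurable lebesgue" and V_pos: "\<And>x. V x > 0"
begin

lemma V_nonneg: "V x \<ge> 0"
  using V_pos[of x] by simp

lemma MV_fin_iff:
  "u \<in> MV_fin s q p V \<longleftrightarrow> u \<in> borel_measurable lebesgue \<and> pow_integral lebesgue V q u < \<infinity> \<and>
     pow_integral (lebesgue \<Otimes>\<^sub>M lebesgue) (gker s p) p (gdiff u) < \<infinity>"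
  by (cases "u \<in> borel_measurable lebesgue") (simp_all add: MV_fin_def Lw_def gagliardo_integral_eq)

lemma MV_norm_eq:
  assumes "u \<in> MV_fin s q p V"
  shows "MV_norm s q p V u = enn2real (pow_integral lebesgue V q u) powr (1 / q) +
    enn2real (pow_integral (lebesgue \<Otimes>\<^sub>M lebesgue) (gker s p) p (gdiff u)) powr (1 / p)"
  using assms
  by (simp add: MV_norm_def Lw_norm_def gagliardo_seminorm_def MV_fin_iff gagliardo_integral_eq)

lemma MV_fin_add:
  assumes "u \<in> MV_fin s q p V" "v \<in> MV_fin s q p V"
  shows "(\<lambda>x. u x + v x) \<in> MV_fin s q p V"
  using assms V_nonneg p q V_meas gker_nonneg unfolding MV_fin_iff gdiff_add
  by (auto intro!: pow_integral_add_finite[unfolded infinity_ennreal_def])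

lemma MV_fin_minus:
  assumes "u \<in> MV_fin s q p V"
  shows "(\<lambda>x. - u x) \<in> MV_fin s q p V"
  using assms unfolding MV_fin_iff gdiff_minus pow_integral_minus by auto

lemma MV_fin_diff:
  assumes "u \<in> MV_fin s q p V" "v \<in> MV_fin s q p V"
  shows "(\<lambda>x. u x - v x) \<in> MV_fin s q p V"
  using MV_fin_add[OF assms(1) MV_fin_minus[OF assms(2)]] by simp

lemma MV_norm_triangle:
  assumes uv: "u \<in> MV_fin s q p V" "v \<in> MV_fin s q p V"
  shows "MV_norm s q p V (\<lambda>x. u x + v x) \<le> MV_norm s q p V u + MV_norm s q p V v"
proof -
  have "enn2real (pow_integral lebesgue V q (\<lambda>x. u x + v x)) powr (1 / q) \<le>
    enn2real (pow_integral lebesgue V q u) powr (1 / q) + enn2real (pow_integral lebesgue V q v) powr (1 / q)"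
    using uv V_nonneg V_meas q by (intro Minkowski) (auto simp: MV_fin_iff)
  moreover have "enn2real (pow_integral (lebesgue \<Otimes>\<^sub>M lebesgue) (gker s p) p (\<lambda>z. gdiff u z + gdiff v z)) powr (1 / p) \<le>
    enn2real (pow_integral (lebesgue \<Otimes>\<^sub>M lebesgue) (gker s p) p (gdiff u)) powr (1 / p) +
    enn2real (pow_integral (lebesgue \<Otimes>\<^sub>M lebesgue) (gker s p) p (gdiff v)) powr (1 / p)"
    using uv p gker_nonneg by (intro Minkowski) (auto simp: MV_fin_iff)
  ultimately show ?thesis
    by (simp add: MV_norm_eq uv MV_fin_add gdiff_add)
qed

lemma MV_norm_minus:
  assumes "u \<in> MV_fin s q p V"
  shows "MV_norm s q p V (\<lambda>x. - u x) = MV_norm s q p V u"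
  using assms by (simp add: MV_norm_eq MV_fin_minus gdiff_minus pow_integral_minus)

lemma MV_norm_nonneg: "MV_norm s q p V u \<ge> 0"
  by (simp add: MV_norm_def Lw_norm_def gagliardo_seminorm_def)

lemma MV_norm_diff_commute: "MV_norm s q p V (\<lambda>x. u x - v x) = MV_norm s q p V (\<lambda>x. v x - u x)"
proof -
  have "\<bar>u x - v x - (u y - v y)\<bar> = \<bar>v x - u x - (v y - u y)\<bar>" for x y
    by linarith
  then show ?thesis
    by (simp add: MV_norm_def Lw_norm_def gagliardo_seminorm_def gagliardo_integral_def
        pow_integral_minus_commute[of _ _ _ u v])
qed

lemma MV_norm_diff_triangle:
  assumes "u \<in> MV_fin s q p V" "v \<in> MV_fin s q p V" "w \<in> MV_fin s q p V"
  shows "MV_norm s q p V (\<lambda>x. u x - w x) \<le>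
    MV_norm s q p V (\<lambda>x. u x - v x) + MV_norm s q p V (\<lambda>x. v x - w x)"
  using MV_norm_triangle[OF MV_fin_diff[OF assms(1,2)] MV_fin_diff[OF assms(2,3)]] by simp

lemma MV_norm_scale:
  assumes u: "u \<in> MV_fin s q p V"
  shows "(\<lambda>x. c * u x) \<in> MV_fin s q p V"
    and "MV_norm s q p V (\<lambda>x. c * u x) = \<bar>c\<bar> * MV_norm s q p V u"
proof -
  have g: "gdiff (\<lambda>x. c * u x) = (\<lambda>z. c * gdiff u z)"
    by (auto simp: gdiff_def fun_eq_iff algebra_simps)
  have um: "u \<in> borel_measurable lebesgue" using u by (simp add: MV_fin_iff)
  note e1 = pow_integral_scale[OF um V_meas V_nonneg, of q c]
  note e2 = pow_integral_scale[OF gdiff_measurable[OF um] gker_measurable[of s p] gker_nonneg[of s p], of p c]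
  show c: "(\<lambda>x. c * u x) \<in> MV_fin s q p V"
    using u um unfolding MV_fin_iff g e1 e2 by (auto simp: ennreal_mult_less_top)
  show "MV_norm s q p V (\<lambda>x. c * u x) = \<bar>c\<bar> * MV_norm s q p V u"
    unfolding MV_norm_eq[OF c] MV_norm_eq[OF u] g e1 e2
    using p q by (simp add: enn2real_mult powr_mult powr_powr distrib_left)
qed

lemma MV_norm_eq_0_iff:
  assumes u: "u \<in> MV_fin s q p V"
  shows "MV_norm s q p V u = 0 \<longleftrightarrow> (AE x in lebesgue. u x = 0)"
proof
  have um [measurable]: "u \<in> borel_measurable lebesgue" using u by (simp add: MV_fin_iff)
  note V_meas [measurable]
  have iff: "pow_integral lebesgue V q u = 0 \<longleftrightarrow> (AE x in lebesgue. u x = 0)"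
  proof -
    have "pow_integral lebesgue V q u = 0 \<longleftrightarrow> (AE x in lebesgue. ennreal (\<bar>u x\<bar> powr q * V x) = 0)"
      unfolding pow_integral_def by (rule nn_integral_0_iff_AE) measurable
    also have "(\<lambda>x. ennreal (\<bar>u x\<bar> powr q * V x) = 0) = (\<lambda>x. u x = 0)"
    proof
      fix x show "ennreal (\<bar>u x\<bar> powr q * V x) = 0 \<longleftrightarrow> u x = 0"
        using V_pos[of x] q
        by (auto simp: ennreal_eq_0_iff mult_le_0_iff not_le powr_le_iff)
    qed
    finally show ?thesis .
  qed
  {
    assume "MV_norm s q p V u = 0"
    then have "enn2real (pow_integral lebesgue V q u) powr (1 / q) = 0"
      unfolding MV_norm_eq[OF u] by (smt (verit) powr_ge_zero)
    then have "pow_integral lebesgue V q u = 0"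
      using u by (auto simp: MV_fin_iff enn2real_eq_0_iff)
    then show "AE x in lebesgue. u x = 0" using iff by simp
  }
  {
    assume ae: "AE x in lebesgue. u x = 0"
    have "gagliardo_integral s p u = (\<integral>\<^sup>+x. \<integral>\<^sup>+y. 0 \<partial>(lebesgue :: 'a measure) \<partial>(lebesgue :: 'a measure))"
      unfolding gagliardo_integral_def
    proof (rule nn_integral_cong_AE, use ae in eventually_elim)
      case (elim x)
      show ?case
      proof (rule nn_integral_cong_AE, use ae in eventually_elim)
        case (elim y)
        then show ?case using \<open>u x = 0\<close> by simp
      qed
    qed
    then show "MV_norm s q p V u = 0"
      using iff ae by (simp add: MV_norm_def Lw_norm_def gagliardo_seminorm_def)
  }
qed

lemma MV_norm_zero: "MV_norm s q p V (\<lambda>x. 0) = 0"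
  by (simp add: MV_norm_def Lw_norm_def gagliardo_seminorm_def gagliardo_integral_def pow_integral_def)

lemma C1c_subset_MV_space: "C1c \<inter> MV_fin s q p V \<subseteq> MV_space s q p V"
proof
  fix u assume "u \<in> C1c \<inter> MV_fin s q p V"
  then show "u \<in> MV_space s q p V"
    unfolding MV_space_def using MV_norm_zero by (auto intro!: exI[of _ "\<lambda>_. u"])
qed

lemma MV_space_dense:
  assumes "u \<in> MV_space s q p V" "e > 0"
  shows "\<exists>v \<in> C1c \<inter> MV_fin s q p V. MV_norm s q p V (\<lambda>x. v x - u x) < e"
proof -
  obtain U where U: "\<And>k. U k \<in> C1c \<inter> MV_fin s q p V"
    "(\<lambda>k. MV_norm s q p V (\<lambda>x. U k x - u x)) \<longlonglongrightarrow> 0"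
    using assms by (auto simp: MV_space_def)
  from order_tendstoD(2)[OF U(2) assms(2)] obtain k where "MV_norm s q p V (\<lambda>x. U k x - u x) < e"
    by (auto simp: eventually_sequentially)
  then show ?thesis using U(1) by blast
qed

lemma MV_space_add:
  assumes u: "u \<in> MV_space s q p V" and v: "v \<in> MV_space s q p V"
  shows "(\<lambda>x. u x + v x) \<in> MV_space s q p V"
proof -
  have f: "u \<in> MV_fin s q p V" "v \<in> MV_fin s q p V" using u v by (auto simp: MV_space_def)
  obtain A where A: "\<And>k. A k \<in> C1c \<inter> MV_fin s q p V"
    "(\<lambda>k. MV_norm s q p V (\<lambda>x. A k x - u x)) \<longlonglongrightarrow> 0"
    using u by (auto simp: MV_space_def)
  obtain B where B: "\<And>k. B k \<in> C1c \<inter> MV_fin s q p V"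
    "(\<lambda>k. MV_norm s q p V (\<lambda>x. B k x - v x)) \<longlonglongrightarrow> 0"
    using v by (auto simp: MV_space_def)
  have "(\<lambda>k. MV_norm s q p V (\<lambda>x. (A k x + B k x) - (u x + v x))) \<longlonglongrightarrow> 0"
  proof (rule tendsto_sandwich[OF _ _ tendsto_const])
    show "(\<lambda>k. MV_norm s q p V (\<lambda>x. A k x - u x) + MV_norm s q p V (\<lambda>x. B k x - v x)) \<longlonglongrightarrow> 0"
      using tendsto_add[OF A(2) B(2)] by simp
    show "\<forall>\<^sub>F k in sequentially. MV_norm s q p V (\<lambda>x. (A k x + B k x) - (u x + v x)) \<le>
      MV_norm s q p V (\<lambda>x. A k x - u x) + MV_norm s q p V (\<lambda>x. B k x - v x)"
    proof (intro always_eventually allI)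
      fix k
      have "(\<lambda>x. (A k x + B k x) - (u x + v x)) = (\<lambda>x. (A k x - u x) + (B k x - v x))"
        by (simp add: fun_eq_iff)
      then show "MV_norm s q p V (\<lambda>x. (A k x + B k x) - (u x + v x)) \<le>
        MV_norm s q p V (\<lambda>x. A k x - u x) + MV_norm s q p V (\<lambda>x. B k x - v x)"
        using MV_norm_triangle[OF MV_fin_diff[of "A k" u] MV_fin_diff[of "B k" v]] A(1)[of k] B(1)[of k] f
        by simp
    qed
  qed (simp add: MV_norm_nonneg)
  moreover have "(\<lambda>x. A k x + B k x) \<in> C1c \<inter> MV_fin s q p V" for k
    using A(1)[of k] B(1)[of k] C1c_add MV_fin_add by blast
  ultimately show ?thesis
    using MV_fin_add[OF f] unfolding MV_space_def
    by (intro CollectI conjI exI[of _ "\<lambda>k x. A k x + B k x"] allI)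
qed

lemma MV_space_scale:
  assumes u: "u \<in> MV_space s q p V"
  shows "(\<lambda>x. c * u x) \<in> MV_space s q p V"
proof -
  have f: "u \<in> MV_fin s q p V" using u by (auto simp: MV_space_def)
  obtain A where A: "\<And>k. A k \<in> C1c \<inter> MV_fin s q p V"
    "(\<lambda>k. MV_norm s q p V (\<lambda>x. A k x - u x)) \<longlonglongrightarrow> 0"
    using u by (auto simp: MV_space_def)
  have "MV_norm s q p V (\<lambda>x. c * A k x - c * u x) = \<bar>c\<bar> * MV_norm s q p V (\<lambda>x. A k x - u x)" for k
    using MV_norm_scale(2)[OF MV_fin_diff[of "A k" u], of c] A(1)[of k] f by (simp add: right_diff_distrib)
  then have "(\<lambda>k. MV_norm s q p V (\<lambda>x. c * A k x - c * u x)) \<longlonglongrightarrow> 0"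
    using tendsto_mult_left[OF A(2), of "\<bar>c\<bar>"] by simp
  moreover have "(\<lambda>x. c * A k x) \<in> C1c \<inter> MV_fin s q p V" for k
    using A(1)[of k] C1c_scale MV_norm_scale(1) by blast
  ultimately show ?thesis
    using MV_norm_scale(1)[OF f, of c] unfolding MV_space_def
    by (intro CollectI conjI exI[of _ "\<lambda>k x. c * A k x"] allI)
qed

theorem MV_space_complete:
  fixes U :: "nat \<Rightarrow> 'a \<Rightarrow> real"
  assumes U: "\<And>k. U k \<in> MV_space s q p V"
    and cauchy: "\<And>e. e > 0 \<Longrightarrow> \<exists>N. \<forall>k\<ge>N. \<forall>m\<ge>N. MV_norm s q p V (\<lambda>x. U k x - U m x) < e"
  shows "\<exists>u\<in>MV_space s q p V. (\<lambda>k. MV_norm s q p V (\<lambda>x. U k x - u x)) \<longlonglongrightarrow> 0"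
proof -
  have Uf: "U k \<in> MV_fin s q p V" for k using U[of k] by (simp add: MV_space_def)
  have Um [measurable]: "U k \<in> borel_measurable lebesgue" for k using Uf[of k] by (simp add: MV_fin_iff)
  note V_meas [measurable]
  let ?L = "lebesgue :: 'a measure"
  let ?LL = "?L \<Otimes>\<^sub>M ?L"
  have bnd: "pow_integral lebesgue V q (\<lambda>x. U k x - U m x) \<le> ennreal (e powr q)"
    "pow_integral ?LL (gker s p) p (\<lambda>z. gdiff (U k) z - gdiff (U m) z) \<le> ennreal (e powr p)"
    if "MV_norm s q p V (\<lambda>x. U k x - U m x) < e" for k m e
  proof -
    have d: "(\<lambda>x. U k x - U m x) \<in> MV_fin s q p V" by (intro MV_fin_diff Uf)
    have e: "e \<ge> 0" using that MV_norm_nonneg[of "\<lambda>x. U k x - U m x"] by linarith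
    have "enn2real (pow_integral lebesgue V q (\<lambda>x. U k x - U m x)) powr (1 / q) \<le> e"
      "enn2real (pow_integral ?LL (gker s p) p (gdiff (\<lambda>x. U k x - U m x))) powr (1 / p) \<le> e"
      using that unfolding MV_norm_eq[OF d] by (smt (verit) powr_ge_zero)+
    then show "pow_integral lebesgue V q (\<lambda>x. U k x - U m x) \<le> ennreal (e powr q)"
      "pow_integral ?LL (gker s p) p (\<lambda>z. gdiff (U k) z - gdiff (U m) z) \<le> ennreal (e powr p)"
      using d e p q by (simp_all add: enn2real_powr_le_iff MV_fin_iff gdiff_diff)
  qed
  have "\<exists>N. \<forall>k\<ge>N. \<forall>m\<ge>N. MV_norm s q p V (\<lambda>x. U k x - U m x) < (1/4) ^ j" for j :: nat
    by (rule cauchy) simp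
  then obtain N where N: "\<And>j k m. k \<ge> N j \<Longrightarrow> m \<ge> N j \<Longrightarrow> MV_norm s q p V (\<lambda>x. U k x - U m x) < (1/4) ^ j"
    by metis
  define \<phi> where "\<phi> j = (\<Sum>i\<le>j. N i) + j" for j
  have \<phi>N: "\<phi> j \<ge> N j" for j
    unfolding \<phi>_def using member_le_sum[of j "{..j}" N] by auto
  have \<phi>_ge: "\<phi> j \<ge> j" for j by (simp add: \<phi>_def)
  have \<phi>_Suc: "\<phi> (Suc j) \<ge> N j" for j
    unfolding \<phi>_def using member_le_sum[of j "{..Suc j}" N] by (auto simp: )
  define D where "D j x = \<bar>U (\<phi> (Suc j)) x - U (\<phi> j) x\<bar>" for j x
  have [measurable]: "D j \<in> borel_measurable lebesgue" for j unfolding D_def by measurable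
  have D_int: "(\<integral>\<^sup>+x. ennreal ((2 ^ j * D j x) powr q * V x) \<partial>lebesgue) \<le> ennreal ((1/2) ^ j)" for j
  proof -
    have "(\<integral>\<^sup>+x. ennreal ((2 ^ j * D j x) powr q * V x) \<partial>lebesgue) =
      (\<integral>\<^sup>+x. ennreal ((2 ^ j) powr q * (\<bar>U (\<phi> (Suc j)) x - U (\<phi> j) x\<bar> powr q * V x)) \<partial>lebesgue)"
      by (simp add: D_def powr_mult mult.assoc)
    also have "\<dots> = ennreal ((2 ^ j) powr q) * pow_integral lebesgue V q (\<lambda>x. U (\<phi> (Suc j)) x - U (\<phi> j) x)"
      by (rule pow_integral_cmult) (auto simp: V_nonneg)
    also have "\<dots> \<le> ennreal ((2 ^ j) powr q) * ennreal (((1/4) ^ j) powr q)"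
      by (intro mult_left_mono bnd N \<phi>N \<phi>_Suc) simp
    also have "\<dots> = ennreal (((1/2) ^ j) powr q)"
      by (simp add: ennreal_mult[symmetric] powr_mult[symmetric] power_mult_distrib[symmetric])
    also have "\<dots> \<le> ennreal ((1/2) ^ j)"
      using powr_mono'[of 1 q "(1/2) ^ j"] q by (intro ennreal_leI) (simp add: power_le_one)
    finally show ?thesis .
  qed
  have "(\<integral>\<^sup>+x. (\<Sum>j. ennreal ((2 ^ j * D j x) powr q * V x)) \<partial>lebesgue) =
    (\<Sum>j. \<integral>\<^sup>+x. ennreal ((2 ^ j * D j x) powr q * V x) \<partial>lebesgue)"
    by (rule nn_integral_suminf) measurable
  also have "\<dots> \<le> (\<Sum>j. ennreal ((1/2) ^ j))"
    by (intro suminf_le D_int) auto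
  also have "\<dots> = ennreal (\<Sum>j. (1/2) ^ j)"
    by (intro suminf_ennreal2) auto
  also have "\<dots> < \<infinity>" by simp
  finally have "(\<integral>\<^sup>+x. (\<Sum>j. ennreal ((2 ^ j * D j x) powr q * V x)) \<partial>lebesgue) \<noteq> \<infinity>"
    by simp
  then have ae1: "AE x in lebesgue. (\<Sum>j. ennreal ((2 ^ j * D j x) powr q * V x)) \<noteq> \<infinity>"
    by (intro nn_integral_noteq_infinite) measurable
  have conv: "convergent (\<lambda>j. U (\<phi> j) x)"
    if x: "(\<Sum>j. ennreal ((2 ^ j * D j x) powr q * V x)) \<noteq> \<infinity>" for x
  proof -
    have "summable (\<lambda>j. (2 ^ j * D j x) powr q * V x)"
      using x V_nonneg by (intro summable_suminf_not_top) auto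
    then have "(\<lambda>j. (2 ^ j * D j x) powr q * V x / V x) \<longlonglongrightarrow> 0 / V x"
      using V_pos[of x] by (intro tendsto_divide summable_LIMSEQ_zero tendsto_const) auto
    then have "(\<lambda>j. (2 ^ j * D j x) powr q) \<longlonglongrightarrow> 0"
      using V_pos[of x] by (simp add: less_imp_neq[symmetric])
    then have "\<forall>\<^sub>F j in sequentially. (2 ^ j * D j x) powr q < 1"
      by (rule order_tendstoD) simp
    then have "\<forall>\<^sub>F j in sequentially. norm (U (\<phi> (Suc j)) x - U (\<phi> j) x) \<le> (1/2) ^ j"
    proof eventually_elim
      case (elim j)
      have "2 ^ j * D j x \<le> 1"
      proof (rule ccontr)
        assume "\<not> ?thesis"
        then have "(2 ^ j * D j x) powr q \<ge> 1" using q by (intro ge_one_powr_ge_zero) auto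
        then show False using elim by simp
      qed
      then show ?case by (simp add: D_def field_simps power_divide)
    qed
    then have "summable (\<lambda>j. U (\<phi> (Suc j)) x - U (\<phi> j) x)"
      by (rule summable_comparison_test_ev) simp
    then have "convergent (\<lambda>j. U (\<phi> j) x - U (\<phi> 0) x)"
      unfolding summable_iff_convergent using sum_lessThan_telescope[of "\<lambda>j. U (\<phi> j) x"] by simp
    then show ?thesis by (simp add: convergent_diff_const_right_iff)
  qed
  define G where "G = {x. convergent (\<lambda>j. U (\<phi> j) x)}"
  have aeG: "AE x in lebesgue. x \<in> G"
    using ae1 by eventually_elim (auto simp: G_def conv)
  define u where "u x = lim (\<lambda>j. U (\<phi> j) x)" for x
  have um [measurable]: "u \<in> borel_measurable lebesgue"
    unfolding u_def by (intro borel_measurable_lim_metric) measurable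
  have lim: "(\<lambda>j. U (\<phi> j) x) \<longlonglongrightarrow> u x" if "x \<in> G" for x
    using that by (simp add: G_def u_def convergent_LIMSEQ_iff)
  have aeGG: "AE z in ?LL. fst z \<in> G \<and> snd z \<in> G"
  proof -
    obtain Z where Z: "{x \<in> space ?L. x \<notin> G} \<subseteq> Z" "Z \<in> null_sets ?L"
      using aeG unfolding eventually_ae_filter by metis
    have "Z \<times> UNIV \<in> null_sets ?LL" "UNIV \<times> Z \<in> null_sets ?LL"
      using Z(2) sigma_finite_measure.emeasure_pair_measure_Times[OF sigma_finite_lebesgue, of Z ?L UNIV]
        sigma_finite_measure.emeasure_pair_measure_Times[OF sigma_finite_lebesgue, of UNIV ?L Z]
      by (auto simp: null_sets_def intro!: pair_measureI)
    then have "Z \<times> UNIV \<union> UNIV \<times> Z \<in> null_sets ?LL" by (rule null_sets.Un)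
    then show ?thesis
      by (rule AE_I') (use Z(1) in auto)
  qed
  have main: "(\<lambda>x. U k x - u x) \<in> MV_fin s q p V \<and> MV_norm s q p V (\<lambda>x. U k x - u x) \<le> 2 * e"
    if e: "e > 0" and N: "\<forall>k\<ge>N0. \<forall>m\<ge>N0. MV_norm s q p V (\<lambda>x. U k x - U m x) < e" and k: "k \<ge> N0" for k N0 e
  proof -
    have ev: "\<forall>\<^sub>F j in sequentially. MV_norm s q p V (\<lambda>x. U k x - U (\<phi> j) x) < e"
      using eventually_ge_at_top[of N0]
      by eventually_elim (use N k \<phi>_ge le_trans in blast)
    have 1: "pow_integral lebesgue V q (\<lambda>x. U k x - u x) \<le> ennreal (e powr q)"
    proof (rule pow_integral_Fatou[where F = "\<lambda>j. U (\<phi> j)"])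
      show "AE x in lebesgue. (\<lambda>j. U (\<phi> j) x) \<longlonglongrightarrow> u x"
        using aeG by eventually_elim (rule lim)
      show "\<forall>\<^sub>F j in sequentially. pow_integral lebesgue V q (\<lambda>x. U k x - U (\<phi> j) x) \<le> ennreal (e powr q)"
        using ev by eventually_elim (rule bnd)
    qed (use q in auto)
    have 2: "pow_integral ?LL (gker s p) p (\<lambda>z. gdiff (U k) z - gdiff u z) \<le> ennreal (e powr p)"
    proof (rule pow_integral_Fatou[where F = "\<lambda>j. gdiff (U (\<phi> j))"])
      show "AE z in ?LL. (\<lambda>j. gdiff (U (\<phi> j)) z) \<longlonglongrightarrow> gdiff u z"
        using aeGG by eventually_elim (auto simp: gdiff_def intro!: tendsto_diff lim)
      show "\<forall>\<^sub>F j in sequentially. pow_integral ?LL (gker s p) p (\<lambda>z. gdiff (U k) z - gdiff (U (\<phi> j)) z) \<le> ennreal (e powr p)"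
        using ev by eventually_elim (rule bnd)
    qed (use p in auto)
    have fin: "(\<lambda>x. U k x - u x) \<in> MV_fin s q p V"
      unfolding MV_fin_iff gdiff_diff using 1 2 by (auto intro: le_less_trans)
    have "enn2real (pow_integral lebesgue V q (\<lambda>x. U k x - u x)) powr (1 / q) \<le> e"
      using 1 e q fin by (subst enn2real_powr_le_iff) (auto simp: MV_fin_iff)
    moreover have "enn2real (pow_integral ?LL (gker s p) p (gdiff (\<lambda>x. U k x - u x))) powr (1 / p) \<le> e"
      using 2 e p fin by (subst enn2real_powr_le_iff) (auto simp: MV_fin_iff gdiff_diff)
    ultimately show ?thesis using fin by (simp add: MV_norm_eq)
  qed
  obtain N1 where "\<forall>k\<ge>N1. \<forall>m\<ge>N1. MV_norm s q p V (\<lambda>x. U k x - U m x) < 1"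
    using cauchy[of 1] by auto
  then have "(\<lambda>x. U N1 x - u x) \<in> MV_fin s q p V"
    using main[of 1 N1 N1] by auto
  from MV_fin_diff[OF Uf[of N1] this] have uf: "u \<in> MV_fin s q p V" by simp
  have tends: "(\<lambda>k. MV_norm s q p V (\<lambda>x. U k x - u x)) \<longlonglongrightarrow> 0"
  proof (rule LIMSEQ_I)
    fix e :: real assume e: "e > 0"
    then obtain N0 where N0: "\<forall>k\<ge>N0. \<forall>m\<ge>N0. MV_norm s q p V (\<lambda>x. U k x - U m x) < e / 4"
      using cauchy[of "e / 4"] by auto
    show "\<exists>no. \<forall>n\<ge>no. norm (MV_norm s q p V (\<lambda>x. U n x - u x) - 0) < e"
      using main[OF _ N0] e MV_norm_nonneg by (intro exI[of _ N0]) force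
  qed
  have "\<exists>v \<in> C1c \<inter> MV_fin s q p V. MV_norm s q p V (\<lambda>x. v x - U k x) < inverse (real (Suc k))" for k
    by (rule MV_space_dense[OF U]) simp
  then obtain W where W: "\<And>k. W k \<in> C1c \<inter> MV_fin s q p V"
    "\<And>k. MV_norm s q p V (\<lambda>x. W k x - U k x) < inverse (real (Suc k))"
    by metis
  have "(\<lambda>k. MV_norm s q p V (\<lambda>x. W k x - u x)) \<longlonglongrightarrow> 0"
  proof (rule tendsto_sandwich[OF _ _ tendsto_const])
    show "(\<lambda>k. inverse (real (Suc k)) + MV_norm s q p V (\<lambda>x. U k x - u x)) \<longlonglongrightarrow> 0"
      using tendsto_add[OF LIMSEQ_inverse_real_of_nat tends] by simp
    show "\<forall>\<^sub>F k in sequentially. MV_norm s q p V (\<lambda>x. W k x - u x) \<le>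
      inverse (real (Suc k)) + MV_norm s q p V (\<lambda>x. U k x - u x)"
    proof (intro always_eventually allI)
      fix k
      show "MV_norm s q p V (\<lambda>x. W k x - u x) \<le> inverse (real (Suc k)) + MV_norm s q p V (\<lambda>x. U k x - u x)"
        using MV_norm_diff_triangle[of "W k" "U k" u] W[of k] Uf[of k] uf by auto
    qed
  qed (simp add: MV_norm_nonneg)
  then have "u \<in> MV_space s q p V"
    unfolding MV_space_def using uf W(1) by blast
  then show ?thesis using tends by blast
qed

end

end

theory Submission
  imports Defs "HOL-Complex_Analysis.Great_Picard"
begin

text \<open>
  Write \<open>P = crit_exp n s p\<close> and \<open>g(x)\<close> for the \<open>p\<close>-th root of the inner Gagliardo integral of \<open>u\<close>.
  Everything rests on the estimate \<open>\<bar>u(x) - mean of u over B(d, e)\<bar> \<le> C e powr s * g(x)\<close> for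
  \<open>x \<in> B(d, e)\<close>. With \<open>d = x\<close>, bounding the mean by the \<open>L\<^sup>P\<close> norm and optimising in \<open>e\<close> gives the
  fractional Sobolev inequality. With \<open>d\<close> in a finite net, and a diagonal subsequence along which
  all means converge, it shows that a bounded sequence has a subsequence that is Cauchy in measure
  on every ball. Finally \<open>\<bar>w\<bar> powr r * K\<close> is pointwise at most
  \<open>\<eta> (\<bar>w\<bar> powr q * V + \<bar>w\<bar> powr P) + C(\<eta>) K powr \<psi>(\<tau>) * V powr (- \<tau>)\<close> for every \<open>\<eta> > 0\<close>; since the
  last weight is integrable, this uniform integrability upgrades Cauchy in measure to Cauchy in
  the weighted space.
\<close>

section \<open>Ball means and the Gagliardo integrand\<close>

text \<open>Stands in for Jensen's inequality: the bound is linear in \<open>a powr p\<close>, so it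
  can be integrated as it stands. When \<open>a\<close> exceeds \<open>t\<close>, the factor
  \<open>(a / t) powr (p - 1)\<close> is at least 1.\<close>

lemma powr_tangent_bound:
  fixes a t p :: real
  assumes "a \<ge> 0" "t > 0" "p \<ge> 1"
  shows "a \<le> t + t powr (1 - p) * a powr p"
proof (cases "a \<le> t")
  case True
  then show ?thesis by (simp add: add_increasing2)
next
  case False
  then have "1 \<le> (a / t) powr (p - 1)"
    using assms by (intro ge_one_powr_ge_zero) auto
  then have "a \<le> a * (a / t) powr (p - 1)"
    using assms by (simp add: mult_le_cancel_left1)
  also have "\<dots> = t powr (1 - p) * a powr p"
    using assms False by (simp add: powr_divide powr_diff powr_minus field_simps)
  finally show ?thesis using assms by simp
qed

text \<open>Jensen's inequality up to the constant 2.\<close>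

lemma set_nn_integral_le_of_powr:
  fixes f :: "'b \<Rightarrow> real"
  assumes [measurable]: "B \<in> sets M" "f \<in> borel_measurable M"
    and fin: "emeasure M B < \<infinity>" and p: "1 \<le> p" and a: "0 < a"
    and le: "(\<integral>\<^sup>+y\<in>B. ennreal (\<bar>f y\<bar> powr p) \<partial>M) \<le> ennreal (a powr p * measure M B)"
  shows "(\<integral>\<^sup>+y\<in>B. ennreal \<bar>f y\<bar> \<partial>M) \<le> ennreal (2 * a * measure M B)"
proof -
  have "(\<integral>\<^sup>+y\<in>B. ennreal \<bar>f y\<bar> \<partial>M) \<le>
    (\<integral>\<^sup>+y. ennreal a * indicator B y + ennreal (a powr (1 - p)) * (ennreal (\<bar>f y\<bar> powr p) * indicator B y) \<partial>M)"
    using powr_tangent_bound[OF abs_ge_zero a p] a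
    by (intro nn_integral_mono)
       (auto simp: indicator_def ennreal_mult[symmetric] ennreal_plus[symmetric] simp del: ennreal_plus intro!: ennreal_leI)
  also have "\<dots> = ennreal a * emeasure M B + ennreal (a powr (1 - p)) * (\<integral>\<^sup>+y\<in>B. ennreal (\<bar>f y\<bar> powr p) \<partial>M)"
    by (subst nn_integral_add) (simp_all add: nn_integral_cmult)
  also have "\<dots> \<le> ennreal a * emeasure M B + ennreal (a powr (1 - p)) * ennreal (a powr p * measure M B)"
    by (intro add_mono mult_left_mono le) auto
  also have "emeasure M B = ennreal (measure M B)"
    using fin by (intro emeasure_eq_ennreal_measure) auto
  also have "ennreal a * ennreal (measure M B) + ennreal (a powr (1 - p)) * ennreal (a powr p * measure M B) =
    ennreal (a * measure M B + a powr (1 - p) * a powr p * measure M B)"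
    using a by (simp add: ennreal_mult[symmetric] ennreal_plus[symmetric] mult.assoc del: ennreal_plus)
  also have "a powr (1 - p) * a powr p = a" using a by (simp add: powr_add[symmetric])
  finally show ?thesis by (simp add: algebra_simps)
qed

definition ball_mean :: "('a::euclidean_space \<Rightarrow> real) \<Rightarrow> 'a \<Rightarrow> real \<Rightarrow> real" where
  "ball_mean u d e = (LINT y:ball d e|lebesgue. u y) / measure lebesgue (ball d e)"

text \<open>\<open>c\<close> minus the mean is the mean of \<open>c - u\<close>, so the Jensen-type
  bound applies. The free constant \<open>c\<close> serves two uses: \<open>c = u x\<close> for the
  oscillation and \<open>c = 0\<close> for the size of the mean itself.\<close>

lemma ball_mean_dist_le:
  fixes u :: "'a::euclidean_space \<Rightarrow> real"
  assumes [measurable]: "u \<in> borel_measurable lebesgue" and e: "e > 0" and a: "a > 0" and p: "1 \<le> p"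
    and le: "(\<integral>\<^sup>+y\<in>ball d e. ennreal (\<bar>c - u y\<bar> powr p) \<partial>lebesgue) \<le> ennreal (a powr p * measure lebesgue (ball d e))"
  shows "\<bar>c - ball_mean u d e\<bar> \<le> 2 * a"
proof -
  let ?B = "ball d e"
  have [measurable]: "?B \<in> sets lebesgue" by simp
  have fin: "emeasure lebesgue ?B < \<infinity>"
    using emeasure_lborel_ball_finite[of d e] by simp
  have B: "measure lebesgue ?B > 0"
    using e by (simp add: content_ball_gt_0_iff)
  have int: "(\<integral>\<^sup>+y\<in>?B. ennreal \<bar>c - u y\<bar> \<partial>lebesgue) \<le> ennreal (2 * a * measure lebesgue ?B)"
    by (rule set_nn_integral_le_of_powr[OF _ _ fin p a le]) auto
  \<comment> \<open>Integrability has to be extracted from the bound; without it the integral in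
    \<open>ball_mean\<close> could be the default value 0.\<close>
  have I: "set_integrable lebesgue ?B (\<lambda>y. c - u y)"
    unfolding set_integrable_def
  proof (rule integrableI_bounded)
    have "(\<integral>\<^sup>+y. ennreal (norm (indicat_real ?B y *\<^sub>R (c - u y))) \<partial>lebesgue) = (\<integral>\<^sup>+y\<in>?B. ennreal \<bar>c - u y\<bar> \<partial>lebesgue)"
      by (intro nn_integral_cong) (auto simp: indicator_def)
    then show "(\<integral>\<^sup>+y. ennreal (norm (indicat_real ?B y *\<^sub>R (c - u y))) \<partial>lebesgue) < \<infinity>"
      using int by (auto intro: le_less_trans)
  qed (use assms(1) in measurable)
  have C: "set_integrable lebesgue ?B (\<lambda>y. c)"
    using fin unfolding set_integrable_def by (simp add: integrable_indicator_iff)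
  have "(LINT y:?B|lebesgue. u y) = (LINT y:?B|lebesgue. c - (c - u y))" by simp
  also have "\<dots> = (LINT y:?B|lebesgue. c) - (LINT y:?B|lebesgue. c - u y)"
    by (rule set_integral_diff[OF C I])
  also have "(LINT y:?B|lebesgue. c) = c * measure lebesgue ?B"
    unfolding set_lebesgue_integral_def using fin by simp
  finally have "c - ball_mean u d e = (LINT y:?B|lebesgue. c - u y) / measure lebesgue ?B"
    using B by (simp add: ball_mean_def field_simps)
  moreover have "ennreal \<bar>LINT y:?B|lebesgue. c - u y\<bar> \<le> (\<integral>\<^sup>+y. ennreal (norm (indicat_real ?B y *\<^sub>R (c - u y))) \<partial>lebesgue)"
    using integral_norm_bound_ennreal[OF I[unfolded set_integrable_def]]
    by (simp add: set_lebesgue_integral_def)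
  then have "ennreal \<bar>LINT y:?B|lebesgue. c - u y\<bar> \<le> (\<integral>\<^sup>+y\<in>?B. ennreal \<bar>c - u y\<bar> \<partial>lebesgue)"
    by (rule order_trans) (auto intro!: nn_integral_mono simp: indicator_def)
  then have "ennreal \<bar>LINT y:?B|lebesgue. c - u y\<bar> \<le> ennreal (2 * a * measure lebesgue ?B)"
    using int by (rule order_trans)
  then have "\<bar>LINT y:?B|lebesgue. c - u y\<bar> \<le> 2 * a * measure lebesgue ?B"
    using a by (subst (asm) ennreal_le_iff) auto
  ultimately show ?thesis using B by (simp add: abs_mult divide_le_eq)
qed

lemma measure_lebesgue_ball:
  fixes d :: "'a::euclidean_space"
  assumes "e > 0"
  shows "measure lebesgue (ball d e) = unit_ball_vol (real DIM('a)) * e powr real DIM('a)"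
  using assms by (simp add: content_ball powr_realpow)

text \<open>The case \<open>c = 0\<close> of \<open>ball_mean_dist_le\<close>; the power of
  \<open>e\<close> comes from the volume of the ball.\<close>

lemma ball_mean_le:
  fixes u :: "'a::euclidean_space \<Rightarrow> real"
  assumes [measurable]: "u \<in> borel_measurable lebesgue" and e: "e > 0" and N: "N > 0" and P: "1 \<le> P"
    and le: "pow_integral lebesgue (\<lambda>_. 1) P u \<le> ennreal (N powr P)"
  shows "\<bar>ball_mean u d e\<bar> \<le> 2 * unit_ball_vol (real DIM('a)) powr (- (1 / P)) * (e powr (- (real DIM('a) / P)) * N)"
proof -
  let ?w = "unit_ball_vol (real DIM('a))"
  have w: "?w > 0" and w0: "?w \<noteq> 0"
    using unit_ball_vol_pos[of "real DIM('a)"] by (simp_all del: unit_ball_vol_pos)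
  define a where "a = ?w powr (- (1 / P)) * (e powr (- (real DIM('a) / P)) * N)"
  have a: "a > 0" using w0 e N by (simp add: a_def)
  have "a powr P * measure lebesgue (ball d e) = N powr P"
    using w0 e N P unfolding a_def measure_lebesgue_ball[OF e]
    by (simp add: powr_mult powr_divide powr_powr powr_minus field_simps)
  moreover have "(\<integral>\<^sup>+y\<in>ball d e. ennreal (\<bar>0 - u y\<bar> powr P) \<partial>lebesgue) \<le> pow_integral lebesgue (\<lambda>_. 1) P u"
    unfolding pow_integral_def by (intro nn_integral_mono) (auto simp: indicator_def)
  ultimately have "\<bar>0 - ball_mean u d e\<bar> \<le> 2 * a"
    using le by (intro ball_mean_dist_le[OF _ e a P]) auto
  then show ?thesis by (simp add: a_def mult.assoc)
qed

text \<open>The \<open>p\<close>-th power of the function g of the introduction. It stays in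
  \<open>ennreal\<close> because it may be infinite at individual points.\<close>

definition gagliardo_at :: "real \<Rightarrow> real \<Rightarrow> ('a::euclidean_space \<Rightarrow> real) \<Rightarrow> 'a \<Rightarrow> ennreal" where
  "gagliardo_at s p u x =
     (\<integral>\<^sup>+y. ennreal (\<bar>u x - u y\<bar> powr p / norm (x - y) powr (real DIM('a) + s * p)) \<partial>lebesgue)"

lemma gagliardo_integral_at: "gagliardo_integral s p u = (\<integral>\<^sup>+x. gagliardo_at s p u x \<partial>lebesgue)"
  by (simp add: gagliardo_integral_def gagliardo_at_def)

lemma gagliardo_at_measurable [measurable]:
  fixes u :: "'a::euclidean_space \<Rightarrow> real"
  assumes [measurable]: "u \<in> borel_measurable lebesgue"
  shows "gagliardo_at s p u \<in> borel_measurable lebesgue"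
proof -
  interpret sigma_finite_measure "lebesgue :: 'a measure" by (rule sigma_finite_lebesgue)
  have "(\<lambda>x. \<integral>\<^sup>+y. ennreal (\<bar>gdiff u (x, y)\<bar> powr p * gker s p (x, y)) \<partial>lebesgue) \<in> borel_measurable lebesgue"
    by (rule borel_measurable_nn_integral_fst) measurable
  then show ?thesis
    unfolding gagliardo_at_def[abs_def] by (simp add: gker_def gdiff_def)
qed

text \<open>The leading 2 comes from the Jensen-type bound, \<open>2 powr (real n + s * p)\<close>
  from the diameter of the ball, and the volume from averaging.\<close>

definition mean_const :: "nat \<Rightarrow> real \<Rightarrow> real \<Rightarrow> real" where
  "mean_const n s p = 2 * (2 powr (real n + s * p) / unit_ball_vol (real n)) powr (1 / p)"

lemma mean_const_pos: "mean_const n s p > 0"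
  using unit_ball_vol_pos[of "real n"] by (simp add: mean_const_def less_imp_neq[symmetric] del: unit_ball_vol_pos)

text \<open>Two points of the ball are less than \<open>2 * e\<close> apart, so the kernel is
  bounded below there and averaging leaves \<open>e powr s * g\<close>. The point \<open>x\<close>
  need not be the centre, which lets finitely many balls serve all points later.\<close>

lemma dist_ball_mean_le_gagliardo:
  fixes u :: "'a::euclidean_space \<Rightarrow> real"
  assumes [measurable]: "u \<in> borel_measurable lebesgue" and x: "x \<in> ball d e" and g: "g > 0"
    and p: "1 \<le> p" and s: "0 < s"
    and le: "gagliardo_at s p u x \<le> ennreal (g powr p)"
  shows "\<bar>u x - ball_mean u d e\<bar> \<le> mean_const DIM('a) s p * (e powr s * g)"
proof -
  let ?n = "real DIM('a)"
  let ?w = "unit_ball_vol ?n"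
  have w: "?w > 0" and w0: "?w \<noteq> 0"
    using unit_ball_vol_pos[of "real DIM('a)"] by (simp_all del: unit_ball_vol_pos)
  have e: "e > 0" using x by (auto intro: le_less_trans[OF zero_le_dist])
  define a where "a = (2 powr (?n + s * p) / ?w) powr (1 / p) * (e powr s * g)"
  have a: "a > 0" using w0 e g by (simp add: a_def)
  have "(\<integral>\<^sup>+y\<in>ball d e. ennreal (\<bar>u x - u y\<bar> powr p) \<partial>lebesgue) \<le>
    (\<integral>\<^sup>+y. ennreal ((2 * e) powr (?n + s * p)) *
      ennreal (\<bar>u x - u y\<bar> powr p / norm (x - y) powr (?n + s * p)) \<partial>lebesgue)"
  proof (rule nn_integral_mono)
    fix y
    have "\<bar>u x - u y\<bar> powr p \<le> (2 * e) powr (?n + s * p) * (\<bar>u x - u y\<bar> powr p / norm (x - y) powr (?n + s * p))"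
      if "y \<in> ball d e" "x \<noteq> y"
    proof -
      have "dist x y < 2 * e"
        using x that dist_triangle[of x y d] by (auto simp: dist_commute)
      then have "norm (x - y) powr (?n + s * p) \<le> (2 * e) powr (?n + s * p)"
        using p s by (intro powr_mono2) (auto simp: dist_norm)
      then show ?thesis
        using that(2) mult_right_mono[of "norm (x - y) powr (?n + s * p)" "(2 * e) powr (?n + s * p)" "\<bar>u x - u y\<bar> powr p"]
        by (simp add: le_divide_eq mult.commute)
    qed
    \<comment> \<open>At \<open>y = x\<close> the quotient takes the default value 0, and the left
      side vanishes as well.\<close>
    then show "ennreal (\<bar>u x - u y\<bar> powr p) * indicator (ball d e) y \<le> ennreal ((2 * e) powr (?n + s * p)) *
      ennreal (\<bar>u x - u y\<bar> powr p / norm (x - y) powr (?n + s * p))"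
      by (cases "x = y") (auto simp: indicator_def ennreal_mult[symmetric] intro!: ennreal_leI)
  qed
  also have "\<dots> = ennreal ((2 * e) powr (?n + s * p)) * gagliardo_at s p u x"
  proof -
    have id [measurable]: "(\<lambda>x::'a. x) \<in> borel_measurable lebesgue"
      by (intro measurable_completion) simp
    show ?thesis unfolding gagliardo_at_def by (rule nn_integral_cmult) measurable
  qed
  also have "\<dots> \<le> ennreal ((2 * e) powr (?n + s * p)) * ennreal (g powr p)"
    by (intro mult_left_mono le) auto
  also have "\<dots> = ennreal (a powr p * measure lebesgue (ball d e))"
    using w0 e g p unfolding a_def measure_lebesgue_ball[OF e]
    by (simp add: ennreal_mult[symmetric] powr_mult powr_powr powr_add field_simps)
  finally have "\<bar>u x - ball_mean u d e\<bar> \<le> 2 * a"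
    by (intro ball_mean_dist_le[OF _ e a p]) auto
  then show ?thesis by (simp add: a_def mean_const_def mult.assoc)
qed


section \<open>The fractional Sobolev inequality\<close>

lemma crit_exp_facts:
  assumes "n > 0" "1 \<le> p" "0 < s" "s * p < real n"
  shows "p < crit_exp n s p" and "p / crit_exp n s p = 1 - s * p / real n"
  using assms by (auto simp: crit_exp_def field_simps)

text \<open>At the balancing radius both contributions carry the same product of powers, so their
  constants simply add.\<close>

definition sobolev_const :: "nat \<Rightarrow> real \<Rightarrow> real \<Rightarrow> real" where
  "sobolev_const n s p = mean_const n s p + 2 * unit_ball_vol (real n) powr (- (1 / crit_exp n s p))"

lemma sobolev_const_pos: "sobolev_const n s p > 0"
  by (simp add: sobolev_const_def mean_const_pos add_pos_nonneg)

text \<open>Compare \<open>u x\<close> with its mean over the ball of radius \<open>e\<close> around \<open>x\<close> and optimise in \<open>e\<close>.\<close>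

lemma sobolev_pointwise:
  fixes u :: "'a::euclidean_space \<Rightarrow> real" and s p :: real
  defines "P \<equiv> crit_exp DIM('a) s p"
  assumes [measurable]: "u \<in> borel_measurable lebesgue" and N: "N > 0"
    and p: "1 \<le> p" and s: "0 < s" "s * p < real DIM('a)"
    and le: "pow_integral lebesgue (\<lambda>_. 1) P u \<le> ennreal (N powr P)"
  shows "ennreal (\<bar>u x\<bar> powr P) \<le> ennreal (sobolev_const DIM('a) s p powr P * N powr (P - p)) * gagliardo_at s p u x"
proof -
  let ?n = "real DIM('a)"
  define C where "C = sobolev_const DIM('a) s p"
  have C: "C > 0" by (simp add: C_def sobolev_const_pos)
  have P: "p < P" "p / P = 1 - s * p / ?n"
    using crit_exp_facts[OF DIM_positive p s] by (auto simp: P_def)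
  define c where "c = C powr P * N powr (P - p)"
  have c: "c > 0" using C N by (simp add: c_def)
  \<comment> \<open>\<open>h\<close> is any positive upper bound, since the integrand may be 0 and
    the choice of radius divides by its root; the margin \<open>d\<close> is sent to 0 at the
    end.\<close>
  have bnd: "\<bar>u x\<bar> powr P \<le> c * h" if h: "h > 0" "gagliardo_at s p u x \<le> ennreal h" for h
  proof -
    define g where "g = h powr (1 / p)"
    have g: "g > 0" "g powr p = h" using h p by (simp_all add: g_def powr_powr)
    \<comment> \<open>The radius at which \<open>e powr s * g\<close> equals
      \<open>e powr (- (?n / P)) * N\<close>; the exponent is \<open>p / ?n\<close> because
      \<open>s + ?n / P = ?n / p\<close>.\<close>
    define e where "e = (N / g) powr (p / ?n)"
    have e: "e > 0" using N g by (simp add: e_def)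
    have e1: "e powr s * g = N powr (1 - p / P) * g powr (p / P)"
      using N g unfolding P(2) e_def by (simp add: powr_powr powr_divide powr_diff mult.commute)
    have e2: "e powr (- (?n / P)) * N = N powr (1 - p / P) * g powr (p / P)"
      using N g unfolding e_def by (simp add: powr_powr powr_divide powr_diff powr_minus field_simps)
    have "\<bar>u x - ball_mean u x e\<bar> \<le> mean_const DIM('a) s p * (e powr s * g)"
      using e g h p s by (intro dist_ball_mean_le_gagliardo) auto
    moreover have "\<bar>ball_mean u x e\<bar> \<le> 2 * unit_ball_vol ?n powr (- (1 / P)) * (e powr (- (?n / P)) * N)"
      using P p by (intro ball_mean_le e N le) auto
    ultimately have "\<bar>u x\<bar> \<le> C * (N powr (1 - p / P) * g powr (p / P))"
      unfolding e1 e2 C_def sobolev_const_def P_def[symmetric] by (simp add: distrib_right)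
    then have "\<bar>u x\<bar> powr P \<le> (C * (N powr (1 - p / P) * g powr (p / P))) powr P"
      using P p by (intro powr_mono2) auto
    also have "\<dots> = c * h"
      using P p by (simp add: c_def powr_mult powr_powr g(2)[symmetric] algebra_simps)
    finally show ?thesis .
  qed
  show ?thesis
  proof (cases "gagliardo_at s p u x")
    case (real h)
    have "\<bar>u x\<bar> powr P \<le> c * h + d" if "d > 0" for d
    proof -
      have "\<bar>u x\<bar> powr P \<le> c * (h + d / c)"
        using real c that by (intro bnd) (auto simp: add_nonneg_pos)
      then show ?thesis using c by (simp add: distrib_left)
    qed
    then have "\<bar>u x\<bar> powr P \<le> c * h" by (rule field_le_epsilon)
    then show ?thesis
      using real c by (simp add: ennreal_mult[symmetric] c_def C_def)
  next
    case top
    then show ?thesis using c by (auto simp: ennreal_mult_top c_def C_def)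
  qed
qed

text \<open>Integrating the pointwise bound with \<open>N powr P\<close> equal to the left integral
  gives N^P \<le> C^P N^(P - p) E, and N^(P - p) is divided out. This absorption needs the left
  integral to be finite, so it is first applied to \<open>C1c\<close> functions.\<close>

lemma sobolev_inequality:
  fixes u :: "'a::euclidean_space \<Rightarrow> real" and s p :: real
  defines "P \<equiv> crit_exp DIM('a) s p"
  assumes [measurable]: "u \<in> borel_measurable lebesgue"
    and p: "1 \<le> p" and s: "0 < s" "s * p < real DIM('a)"
    and fin: "pow_integral lebesgue (\<lambda>_. 1) P u < \<infinity>" "gagliardo_integral s p u < \<infinity>"
  shows "pow_integral lebesgue (\<lambda>_. 1) P u \<le>
    ennreal ((sobolev_const DIM('a) s p powr (P / p) * gagliardo_seminorm s p u) powr P)"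
proof (cases "pow_integral lebesgue (\<lambda>_. 1) P u = 0")
  case False
  define C where "C = sobolev_const DIM('a) s p"
  have C: "C > 0" by (simp add: C_def sobolev_const_pos)
  have P: "p < P" using crit_exp_facts[OF DIM_positive p s] by (auto simp: P_def)
  obtain I where I: "I \<ge> 0" "pow_integral lebesgue (\<lambda>_. 1) P u = ennreal I"
    using fin(1) by (cases "pow_integral lebesgue (\<lambda>_. 1) P u") auto
  have I0: "I > 0" using False I by (cases "I = 0") auto
  obtain E where E: "E \<ge> 0" "gagliardo_integral s p u = ennreal E"
    using fin(2) by (cases "gagliardo_integral s p u") auto
  define N where "N = I powr (1 / P)"
  have N: "N > 0" "N powr P = I" using I0 P p by (simp_all add: N_def powr_powr)
  have "ennreal I = (\<integral>\<^sup>+x. ennreal (\<bar>u x\<bar> powr P) \<partial>lebesgue)"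
    using I by (simp add: pow_integral_def)
  also have "\<dots> \<le> (\<integral>\<^sup>+x. ennreal (C powr P * N powr (P - p)) * gagliardo_at s p u x \<partial>lebesgue)"
    unfolding C_def P_def
    by (intro nn_integral_mono sobolev_pointwise) (use N I p s in \<open>auto simp: P_def\<close>)
  also have "\<dots> = ennreal (C powr P * N powr (P - p)) * ennreal E"
    by (subst nn_integral_cmult) (simp_all add: gagliardo_integral_at[symmetric] E)
  also have "\<dots> = ennreal (C powr P * N powr (P - p) * E)"
    using E by (simp add: ennreal_mult)
  finally have "N powr P \<le> C powr P * N powr (P - p) * E"
    using E N by (subst (asm) ennreal_le_iff) auto
  then have "N powr p \<le> C powr P * E"
    using N(1) by (simp add: powr_diff field_simps)
  then have "(N powr p) powr (P / p) \<le> (C powr P * E) powr (P / p)"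
    using P p by (intro powr_mono2) auto
  also have "(N powr p) powr (P / p) = I"
    using p N(2) by (simp add: powr_powr)
  also have "(C powr P * E) powr (P / p) = (C powr (P / p) * E powr (1 / p)) powr P"
    by (simp add: powr_mult powr_powr mult.commute)
  finally show ?thesis
    using I E by (simp add: C_def gagliardo_seminorm_def)
qed simp

section \<open>Extension of the Sobolev inequality to the completion\<close>

lemma C1c_continuous: "u \<in> C1c \<Longrightarrow> continuous_on UNIV u"
  unfolding C1c_def
  by (auto intro!: continuous_at_imp_continuous_on intro: has_derivative_continuous)

text \<open>A continuous function with compact support is bounded; this supplies the finiteness that
  \<open>sobolev_inequality\<close> asks for.\<close>

lemma C1c_pow_integral_finite:
  fixes u :: "'a::euclidean_space \<Rightarrow> real"
  assumes u: "u \<in> C1c" and P: "P > 0"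
  shows "pow_integral lebesgue (\<lambda>_. 1) P u < \<infinity>"
proof -
  let ?S = "closure {x. u x \<noteq> 0}"
  have S: "compact ?S" using u by (simp add: C1c_def)
  have "compact (u ` ?S)"
    by (intro compact_continuous_image S continuous_on_subset[OF C1c_continuous[OF u]]) auto
  then obtain b where b: "\<And>x. x \<in> ?S \<Longrightarrow> \<bar>u x\<bar> \<le> b"
    using compact_imp_bounded bounded_iff by (metis image_eqI real_norm_def)
  have "pow_integral lebesgue (\<lambda>_. 1) P u \<le> (\<integral>\<^sup>+x. ennreal (b powr P) * indicator ?S x \<partial>lebesgue)"
    unfolding pow_integral_def
  proof (rule nn_integral_mono)
    fix x
    show "ennreal (\<bar>u x\<bar> powr P * 1) \<le> ennreal (b powr P) * indicator ?S x"
    proof (cases "x \<in> ?S")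
      case True
      then show ?thesis using b[OF True] P by (auto intro!: ennreal_leI powr_mono2)
    next
      case False
      then have "u x = 0" using closure_subset[of "{x. u x \<noteq> 0}"] by auto
      then show ?thesis by simp
    qed
  qed
  also have "\<dots> = ennreal (b powr P) * emeasure lebesgue ?S"
    by (intro nn_integral_cmult_indicator) auto
  also have "\<dots> < \<infinity>"
    using emeasure_compact_finite[OF S] by (simp add: ennreal_mult_less_top)
  finally show ?thesis .
qed

lemma MV_norm_le_bounds:
  fixes u :: "'a::euclidean_space \<Rightarrow> real"
  assumes u: "u \<in> MV_fin s q p V" and pq: "1 \<le> p" "1 \<le> q" and M: "MV_norm s q p V u \<le> M"
  shows "pow_integral lebesgue V q u \<le> ennreal (M powr q)"
    and "gagliardo_integral s p u \<le> ennreal (M powr p)"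
    and "gagliardo_seminorm s p u \<le> M"
proof -
  have "Lw_norm q V u \<ge> 0" "gagliardo_seminorm s p u \<ge> 0"
    by (simp_all add: Lw_norm_def gagliardo_seminorm_def)
  then have le: "Lw_norm q V u \<le> M" "gagliardo_seminorm s p u \<le> M" "M \<ge> 0"
    using M by (simp_all add: MV_norm_def)
  show "gagliardo_seminorm s p u \<le> M" by fact
  show "pow_integral lebesgue V q u \<le> ennreal (M powr q)"
    using enn2real_powr_le_iff[of "pow_integral lebesgue V q u" q M] le u pq
    by (simp add: Lw_norm_def MV_fin_def Lw_def)
  show "gagliardo_integral s p u \<le> ennreal (M powr p)"
    using enn2real_powr_le_iff[of "gagliardo_integral s p u" p M] le u pq
    by (simp add: gagliardo_seminorm_def MV_fin_def)
qed

text \<open>The functions \<open>\<bar>F k x\<bar> powr q * W x\<close> tend to 0 in L^1, hence a.e.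
  along a subsequence; positivity of \<open>W\<close> allows division by it.\<close>

lemma pow_integral_AE_subseq:
  assumes [measurable]: "\<And>k::nat. F k \<in> borel_measurable M" "W \<in> borel_measurable M"
    and W: "\<And>x. W x > 0" and q: "q > 0"
    and lim: "(\<lambda>k. pow_integral M W q (F k)) \<longlonglongrightarrow> 0"
    and fin: "\<And>k. pow_integral M W q (F k) < \<infinity>"
  obtains r :: "nat \<Rightarrow> nat" where "strict_mono r" "AE x in M. (\<lambda>k. F (r k) x) \<longlonglongrightarrow> 0"
proof -
  have Wn: "W x \<ge> 0" for x using W[of x] by simp
  have int: "integrable M (\<lambda>x. \<bar>F k x\<bar> powr q * W x)" for k
    using fin[of k] Wn by (intro integrableI_bounded) (auto simp: pow_integral_def abs_mult)
  have "ennreal (\<integral>x. norm (\<bar>F k x\<bar> powr q * W x) \<partial>M) = pow_integral M W q (F k)" for k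
    using nn_integral_eq_integral[OF int, of k] Wn by (simp add: pow_integral_def abs_mult)
  then have "(\<lambda>k. ennreal (\<integral>x. norm (\<bar>F k x\<bar> powr q * W x) \<partial>M)) \<longlonglongrightarrow> ennreal 0"
    using lim by simp
  then have "(\<lambda>k. \<integral>x. norm (\<bar>F k x\<bar> powr q * W x) \<partial>M) \<longlonglongrightarrow> 0"
    by (subst (asm) tendsto_ennreal_iff) auto
  from tendsto_L1_AE_subseq[OF int this] obtain r :: "nat \<Rightarrow> nat" where r: "strict_mono r"
    "AE x in M. (\<lambda>k. \<bar>F (r k) x\<bar> powr q * W x) \<longlonglongrightarrow> 0" by auto
  have "(\<lambda>k. F (r k) x) \<longlonglongrightarrow> 0" if "(\<lambda>k. \<bar>F (r k) x\<bar> powr q * W x) \<longlonglongrightarrow> 0" for x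
  proof -
    have "(\<lambda>k. (\<bar>F (r k) x\<bar> powr q * W x / W x) powr (1 / q)) \<longlonglongrightarrow> (0 / W x) powr (1 / q)"
      using W[of x] q by (intro tendsto_powr' tendsto_divide that tendsto_const) (auto simp: Wn)
    then have "(\<lambda>k. \<bar>F (r k) x\<bar>) \<longlonglongrightarrow> 0"
      using W[of x] q by (simp add: powr_powr less_imp_neq[symmetric])
    then show ?thesis by (rule tendsto_rabs_zero_cancel)
  qed
  then have "AE x in M. (\<lambda>k. F (r k) x) \<longlonglongrightarrow> 0"
    using r(2) by (auto elim: eventually_mono)
  then show ?thesis using r(1) that by blast
qed

text \<open>Approximants in \<open>C1c\<close> satisfy the Sobolev inequality and converge to
  \<open>u\<close> a.e. along a subsequence, so Fatou transfers the bound. Approximants within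
  distance 1 of \<open>u\<close> have norm at most \<open>M + 1\<close>, whence the
  constant.\<close>

lemma MV_space_sobolev:
  fixes u :: "'a::euclidean_space \<Rightarrow> real" and s p :: real
  defines "P \<equiv> crit_exp DIM('a) s p"
  assumes pq: "1 \<le> p" "1 \<le> q" and s: "0 < s" "s * p < real DIM('a)"
    and V: "V \<in> borel_measurable lebesgue" "\<And>x. V x > 0"
    and u: "u \<in> MV_space s q p V" and M: "MV_norm s q p V u \<le> M"
  shows "pow_integral lebesgue (\<lambda>_. 1) P u \<le> ennreal ((sobolev_const DIM('a) s p powr (P / p) * (M + 1)) powr P)"
proof -
  let ?C = "sobolev_const DIM('a) s p powr (P / p)"
  note V_meas [measurable] = V(1)
  have P: "p < P" using crit_exp_facts[OF DIM_positive pq(1) s] by (auto simp: P_def)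
  obtain U where U: "\<And>k. U k \<in> C1c" "\<And>k. U k \<in> MV_fin s q p V"
    and lim: "(\<lambda>k. MV_norm s q p V (\<lambda>x. U k x - u x)) \<longlonglongrightarrow> 0" and uf: "u \<in> MV_fin s q p V"
    using u by (auto simp: MV_space_def)
  have [measurable]: "U k \<in> borel_measurable lebesgue" "u \<in> borel_measurable lebesgue" for k
    using U(2)[of k] uf by (auto simp: MV_fin_def Lw_def)
  have d: "(\<lambda>x. U k x - u x) \<in> MV_fin s q p V" for k
    by (rule MV_fin_diff[OF pq V U(2) uf])
  have "\<forall>\<^sub>F k in sequentially. MV_norm s q p V (\<lambda>x. U k x - u x) < 1"
    by (rule order_tendstoD(2)[OF lim]) simp
  then have ev: "\<forall>\<^sub>F k in sequentially. pow_integral lebesgue (\<lambda>_. 1) P (U k) \<le> ennreal ((?C * (M + 1)) powr P)"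
  proof eventually_elim
    case (elim k)
    have "MV_norm s q p V (\<lambda>x. (U k x - u x) + u x) \<le> MV_norm s q p V (\<lambda>x. U k x - u x) + MV_norm s q p V u"
      by (rule MV_norm_triangle[OF pq V d uf])
    then have "MV_norm s q p V (U k) \<le> M + 1" using elim M by simp
    then have g: "gagliardo_seminorm s p (U k) \<le> M + 1"
      by (rule MV_norm_le_bounds(3)[OF U(2) pq])
    have "pow_integral lebesgue (\<lambda>_. 1) P (U k) \<le> ennreal ((?C * gagliardo_seminorm s p (U k)) powr P)"
      unfolding P_def
    proof (rule sobolev_inequality)
      show "pow_integral lebesgue (\<lambda>_. 1) (crit_exp DIM('a) s p) (U k) < \<infinity>"
        using P pq by (intro C1c_pow_integral_finite U) (simp add: P_def)
      show "gagliardo_integral s p (U k) < \<infinity>" using U(2)[of k] by (simp add: MV_fin_def)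
    qed (use pq s in auto)
    also have "\<dots> \<le> ennreal ((?C * (M + 1)) powr P)"
      using g P pq by (intro ennreal_leI powr_mono2 mult_left_mono) (auto simp: gagliardo_seminorm_def)
    finally show ?case .
  qed
  have "(\<lambda>k. pow_integral lebesgue V q (\<lambda>x. U k x - u x)) \<longlonglongrightarrow> 0"
  proof (rule tendsto_sandwich[OF _ _ tendsto_const])
    have "(\<lambda>k. ennreal (MV_norm s q p V (\<lambda>x. U k x - u x) powr q)) \<longlonglongrightarrow> ennreal (0 powr q)"
      using pq lim by (intro tendsto_ennrealI tendsto_powr' lim tendsto_const) (auto simp: MV_norm_nonneg[OF pq V])
    then show "(\<lambda>k. ennreal (MV_norm s q p V (\<lambda>x. U k x - u x) powr q)) \<longlonglongrightarrow> 0" by simp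
  qed (auto intro!: always_eventually MV_norm_le_bounds(1)[OF d pq])
  moreover have "pow_integral lebesgue V q (\<lambda>x. U k x - u x) < \<infinity>" for k
    using d[of k] by (simp add: MV_fin_def Lw_def)
  ultimately obtain r :: "nat \<Rightarrow> nat" where r: "strict_mono r" "AE x in lebesgue. (\<lambda>k. U (r k) x - u x) \<longlonglongrightarrow> 0"
    using pq V by (elim pow_integral_AE_subseq[rotated 4]) auto
  \<comment> \<open>The zero function in front fits the shape of \<open>pow_integral_Fatou\<close>,
    which bounds differences \<open>f x - F j x\<close>.\<close>
  have "pow_integral lebesgue (\<lambda>_. 1) P (\<lambda>x. 0 - u x) \<le> ennreal ((?C * (M + 1)) powr P)"
  proof (rule pow_integral_Fatou[where F = "\<lambda>k. U (r k)"])
    show "AE x in lebesgue. (\<lambda>k. U (r k) x) \<longlonglongrightarrow> u x"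
      using r(2) by eventually_elim (simp add: LIM_zero_iff)
    show "\<forall>\<^sub>F k in sequentially. pow_integral lebesgue (\<lambda>_. 1) P (\<lambda>x. 0 - U (r k) x) \<le> ennreal ((?C * (M + 1)) powr P)"
      using eventually_subseq[OF r(1) ev] by (simp add: pow_integral_minus)
  qed (use P pq in auto)
  then show ?thesis by (simp add: pow_integral_minus)
qed


section \<open>Compactness in measure\<close>

lemma emeasure_superlevel_le:
  assumes [measurable]: "f \<in> borel_measurable M" and c: "c > 0"
  shows "emeasure M {x \<in> space M. f x > ennreal c} \<le> ennreal (1 / c) * (\<integral>\<^sup>+x. f x \<partial>M)"
proof -
  have "{x \<in> space M. f x > ennreal c} \<subseteq> {x \<in> space M. 1 \<le> ennreal (1 / c) * f x}"
  proof safe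
    fix x assume "f x > ennreal c"
    then have "ennreal (1 / c) * ennreal c \<le> ennreal (1 / c) * f x"
      by (intro mult_left_mono) auto
    then show "1 \<le> ennreal (1 / c) * f x"
      using c by (simp add: ennreal_mult[symmetric])
  qed
  then have "emeasure M {x \<in> space M. f x > ennreal c} \<le> emeasure M {x \<in> space M. 1 \<le> ennreal (1 / c) * f x}"
    by (intro emeasure_mono) auto
  also have "\<dots> \<le> ennreal (1 / c) * (\<integral>\<^sup>+x. f x * indicator (space M) x \<partial>M)"
    by (intro nn_integral_Markov_inequality) auto
  also have "(\<integral>\<^sup>+x. f x * indicator (space M) x \<partial>M) = (\<integral>\<^sup>+x. f x \<partial>M)"
    by (intro nn_integral_cong) auto
  finally show ?thesis .
qed

text \<open>
  Along a diagonal subsequence all means over the balls of countably many finite nets converge; up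
  to a set of small measure each function is uniformly close to its means.
\<close>

lemma gagliardo_bounded_Cauchy_in_measure:
  fixes U :: "nat \<Rightarrow> 'a::euclidean_space \<Rightarrow> real"
  assumes U [measurable]: "\<And>k. U k \<in> borel_measurable lebesgue"
    and p: "1 \<le> p" and s: "0 < s" and P: "1 \<le> P" and N: "N > 0" and B: "B \<ge> 0"
    and bound_P: "\<And>k. pow_integral lebesgue (\<lambda>_. 1) P (U k) \<le> ennreal (N powr P)"
    and bound_G: "\<And>k. gagliardo_integral s p (U k) \<le> ennreal B"
  shows "\<exists>\<phi> :: nat \<Rightarrow> nat. strict_mono \<phi> \<and> (\<forall>R. \<forall>\<delta>>0. \<forall>e>0. \<exists>n. \<forall>k\<ge>n. \<forall>m\<ge>n.
    emeasure lebesgue {x \<in> ball 0 R. \<bar>U (\<phi> k) x - U (\<phi> m) x\<bar> > \<delta>} \<le> ennreal e)"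
proof -
  define \<epsilon> where "\<epsilon> j = inverse (real (Suc j))" for j
  have \<epsilon>: "\<epsilon> j > 0" for j by (simp add: \<epsilon>_def)
  have "\<exists>F. finite F \<and> cball (0::'a) (real j) \<subseteq> (\<Union>d\<in>F. ball d (\<epsilon> j))" for j
    using seq_compact_imp_totally_bounded[OF compact_imp_seq_compact[OF compact_cball[of "0::'a" "real j"]]] \<epsilon>[of j]
    by blast
  then obtain F where F: "\<And>j. finite (F j)" "\<And>j. cball (0::'a) (real j) \<subseteq> (\<Union>d\<in>F j. ball d (\<epsilon> j))"
    by metis
  define D where "D j = 2 * unit_ball_vol (real DIM('a)) powr (- (1 / P)) * (\<epsilon> j powr (- (real DIM('a) / P)) * N)" for j
  have D: "\<bar>ball_mean (U k) d (\<epsilon> j)\<bar> \<le> D j" for k d j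
    unfolding D_def by (rule ball_mean_le[OF U \<epsilon> N P bound_P])
  have D0: "D j \<ge> 0" for j using D[of 0 0 j] by linarith
  \<comment> \<open>Pairs of a centre and a scale index all means at once. Division by
    \<open>D (snd i) + 1\<close> gives the common bound 1 needed for the diagonal argument; the
    added 1 rules out division by 0.\<close>
  define f where "f k i = ball_mean (U k) (fst i) (\<epsilon> (snd i)) / (D (snd i) + 1)" for k and i :: "'a \<times> nat"
  have "countable (\<Union>j. F j \<times> {j})"
    using F(1) by (intro countable_UN countable_SIGMA) (auto intro: countable_finite)
  moreover have "norm (f k i) \<le> 1" for k i
    using D[of k "fst i" "snd i"] D0[of "snd i"] by (simp add: f_def divide_le_eq)
  ultimately obtain \<phi> :: "nat \<Rightarrow> nat" where \<phi>: "strict_mono \<phi>"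
    and lim: "\<And>i. i \<in> (\<Union>j. F j \<times> {j}) \<Longrightarrow> \<exists>l. (\<lambda>k. f (\<phi> k) i) \<longlonglongrightarrow> l"
    by (rule function_convergent_subsequence[where f = f and M = 1]) auto
  have lim': "\<exists>l. (\<lambda>k. ball_mean (U (\<phi> k)) d (\<epsilon> j)) \<longlonglongrightarrow> l" if d: "d \<in> F j" for d j
  proof -
    obtain l where "(\<lambda>k. f (\<phi> k) (d, j)) \<longlonglongrightarrow> l" using lim[of "(d, j)"] d by auto
    then have "(\<lambda>k. (D j + 1) * f (\<phi> k) (d, j)) \<longlonglongrightarrow> (D j + 1) * l"
      by (intro tendsto_mult_left)
    then show ?thesis
      using D0[of j] by (auto simp: f_def add_nonneg_eq_0_iff)
  qed
  show ?thesis
  proof (intro exI[of _ \<phi>] conjI \<phi> allI impI)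
    fix R \<delta> e :: real assume \<delta>: "0 < \<delta>" and e: "0 < e"
    \<comment> \<open>By Markov's inequality the set where \<open>gagliardo_at\<close> exceeds
      \<open>h powr p\<close> has measure at most \<open>e * B / (2 * B + 1)\<close>, hence at most
      \<open>e / 2\<close>; the added 1 keeps \<open>h\<close> positive for
      \<open>B = 0\<close>.\<close>
    define h where "h = ((2 * B + 1) / e) powr (1 / p)"
    have h: "h > 0" "h powr p = (2 * B + 1) / e"
      using B e p by (simp_all add: h_def powr_powr add_nonneg_eq_0_iff)
    have "(\<lambda>j. mean_const DIM('a) s p * (\<epsilon> j powr s * h)) \<longlonglongrightarrow> mean_const DIM('a) s p * (0 powr s * h)"
      unfolding \<epsilon>_def using s
      by (intro tendsto_mult tendsto_const tendsto_powr' LIMSEQ_inverse_real_of_nat) auto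
    then have "(\<lambda>j. mean_const DIM('a) s p * (\<epsilon> j powr s * h)) \<longlonglongrightarrow> 0" by simp
    then have "\<forall>\<^sub>F j in sequentially. mean_const DIM('a) s p * (\<epsilon> j powr s * h) < \<delta> / 4"
      using \<delta> by (intro order_tendstoD) auto
    moreover have "\<forall>\<^sub>F j in sequentially. R \<le> real j"
      using filterlim_real_sequentially by (simp add: filterlim_at_top)
    \<comment> \<open>Scale \<open>j\<close> is fine enough for functions outside the exceptional
      set to lie within \<open>\<delta> / 4\<close> of their means, and its net covers the ball of
      radius \<open>R\<close>.\<close>
    ultimately have "\<forall>\<^sub>F j in sequentially. mean_const DIM('a) s p * (\<epsilon> j powr s * h) < \<delta> / 4 \<and> R \<le> real j"
      by (rule eventually_conj)
    from eventually_happens'[OF sequentially_bot this]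
    obtain j where j: "mean_const DIM('a) s p * (\<epsilon> j powr s * h) < \<delta> / 4" "R \<le> real j" by blast
    have "\<forall>d\<in>F j. \<exists>l. (\<lambda>k. ball_mean (U (\<phi> k)) d (\<epsilon> j)) \<longlonglongrightarrow> l"
      using lim' by blast
    from bchoice[OF this] obtain l
      where l: "\<And>d. d \<in> F j \<Longrightarrow> (\<lambda>k. ball_mean (U (\<phi> k)) d (\<epsilon> j)) \<longlonglongrightarrow> l d" by blast
    have "\<forall>\<^sub>F k in sequentially. \<forall>d\<in>F j. dist (ball_mean (U (\<phi> k)) d (\<epsilon> j)) (l d) < \<delta> / 4"
      using F(1) \<delta> by (intro eventually_ball_finite ballI tendstoD l) auto
    then obtain n where n: "\<And>k d. k \<ge> n \<Longrightarrow> d \<in> F j \<Longrightarrow> \<bar>ball_mean (U (\<phi> k)) d (\<epsilon> j) - l d\<bar> < \<delta> / 4"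
      by (auto simp: eventually_sequentially dist_real_def)
    define T where "T k = {x \<in> space lebesgue. gagliardo_at s p (U k) x > ennreal (h powr p)}" for k
    have [measurable]: "T k \<in> sets lebesgue" for k unfolding T_def by measurable
    have T: "emeasure lebesgue (T k) \<le> ennreal (e / 2)" for k
    proof -
      have "emeasure lebesgue (T k) \<le> ennreal (1 / h powr p) * gagliardo_integral s p (U k)"
        unfolding T_def gagliardo_integral_at using h(1) by (intro emeasure_superlevel_le gagliardo_at_measurable U) simp
      also have "\<dots> \<le> ennreal (1 / h powr p) * ennreal B"
        by (intro mult_left_mono bound_G) auto
      also have "\<dots> = ennreal (e * B / (2 * B + 1))"
        using B e unfolding h(2) by (simp add: ennreal_mult[symmetric])
      also have "\<dots> \<le> ennreal (e / 2)"
        using B e by (intro ennreal_leI) (simp add: field_simps)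
      finally show ?thesis .
    qed
    have "emeasure lebesgue {x \<in> ball 0 R. \<bar>U (\<phi> k) x - U (\<phi> m) x\<bar> > \<delta>} \<le> ennreal e" if km: "k \<ge> n" "m \<ge> n" for k m
    proof -
      \<comment> \<open>Off both exceptional sets each function is within
        \<open>\<delta> / 4\<close> of its mean on a net ball, and that mean within
        \<open>\<delta> / 4\<close> of its limit; both functions are compared with the same limit
        \<open>l d\<close>.\<close>
      have "{x \<in> ball 0 R. \<bar>U (\<phi> k) x - U (\<phi> m) x\<bar> > \<delta>} \<subseteq> T (\<phi> k) \<union> T (\<phi> m)"
      proof (rule subsetI, rule ccontr)
        fix x assume x: "x \<in> {x \<in> ball 0 R. \<bar>U (\<phi> k) x - U (\<phi> m) x\<bar> > \<delta>}" "x \<notin> T (\<phi> k) \<union> T (\<phi> m)"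
        have "x \<in> cball 0 (real j)" using x j by auto
        then obtain d where d: "d \<in> F j" "x \<in> ball d (\<epsilon> j)" using F(2)[of j] by blast
        have "\<bar>U (\<phi> i) x - l d\<bar> < \<delta> / 2" if "i \<ge> n" "x \<notin> T (\<phi> i)" for i
        proof -
          have "\<bar>U (\<phi> i) x - ball_mean (U (\<phi> i)) d (\<epsilon> j)\<bar> \<le> mean_const DIM('a) s p * (\<epsilon> j powr s * h)"
            using that by (intro dist_ball_mean_le_gagliardo d h p s U) (auto simp: T_def not_less)
          then show ?thesis using n[OF that(1) d(1)] j(1) by linarith
        qed
        then have "\<bar>U (\<phi> k) x - l d\<bar> < \<delta> / 2" "\<bar>U (\<phi> m) x - l d\<bar> < \<delta> / 2"
          using km x(2) by blast+
        moreover have "\<bar>U (\<phi> k) x - U (\<phi> m) x\<bar> > \<delta>" using x(1) by blast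
        ultimately show False by linarith
      qed
      then have "emeasure lebesgue {x \<in> ball 0 R. \<bar>U (\<phi> k) x - U (\<phi> m) x\<bar> > \<delta>} \<le>
        emeasure lebesgue (T (\<phi> k) \<union> T (\<phi> m))"
        by (intro emeasure_mono) auto
      also have "\<dots> \<le> emeasure lebesgue (T (\<phi> k)) + emeasure lebesgue (T (\<phi> m))"
        by (intro emeasure_subadditive) auto
      also have "\<dots> \<le> ennreal (e / 2) + ennreal (e / 2)" by (intro add_mono T)
      also have "\<dots> = ennreal e" using e by (simp add: ennreal_plus[symmetric] del: ennreal_plus)
      finally show ?thesis .
    qed
    then show "\<exists>n. \<forall>k\<ge>n. \<forall>m\<ge>n. emeasure lebesgue {x \<in> ball 0 R. \<bar>U (\<phi> k) x - U (\<phi> m) x\<bar> > \<delta>} \<le> ennreal e"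
      by blast
  qed
qed


section \<open>Interpolation of the weights\<close>

text \<open>
  The left-hand side is a weighted geometric mean of the three terms on the right, with exponents
  \<open>\<alpha>\<close>, \<open>\<beta>\<close>, \<open>\<gamma>\<close> satisfying \<open>1 / \<gamma> = psi P q r \<tau>\<close> and \<open>\<alpha> / \<gamma> = \<tau>\<close>.
\<close>

lemma weight_interpolation:
  fixes P q r \<tau> \<eta> :: real
  assumes r: "1 \<le> r" "r < P" "r < q" and \<tau>: "0 \<le> \<tau>" "\<tau> \<le> r / (q - r)" and \<eta>: "\<eta> > 0"
  obtains C where "C > 0"
    "\<And>w k v. k > 0 \<Longrightarrow> v > 0 \<Longrightarrow>
      \<bar>w\<bar> powr r * k \<le> \<eta> * (\<bar>w\<bar> powr q * v) + \<eta> * \<bar>w\<bar> powr P + C * (k powr psi P q r \<tau> * v powr (- \<tau>))"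
proof -
  define d where "d = P + \<tau> * (P - q)"
  have \<tau>': "\<tau> * (q - r) \<le> r" using \<tau> r by (simp add: le_divide_eq)
  \<comment> \<open>For \<open>P < q\<close>, positivity of the numerator of \<open>psi\<close>
    rests on the upper bound for \<open>\<tau>\<close>, which yields
    \<open>(q - r) * d \<ge> q * (P - r)\<close>.\<close>
  have d: "d > 0"
  proof (cases "P \<ge> q")
    case True
    then show ?thesis using \<tau> r by (simp add: d_def add_pos_nonneg)
  next
    case False
    have "(\<tau> * (q - r)) * (q - P) \<le> r * (q - P)" using \<tau>' False by (intro mult_right_mono) auto
    then have "(q - r) * d \<ge> P * (q - r) - r * (q - P)" by (simp add: d_def algebra_simps)
    also have "P * (q - r) - r * (q - P) = q * (P - r)" by (simp add: algebra_simps)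
    finally have "(q - r) * d > 0" using r by (auto intro: less_le_trans[of 0 "q * (P - r)"])
    then show ?thesis using r by (simp add: zero_less_mult_iff)
  qed
  define \<gamma> where "\<gamma> = (P - r) / d"
  define \<alpha> where "\<alpha> = \<tau> * \<gamma>"
  \<comment> \<open>\<open>\<beta>\<close> is forced by equating the powers of
    \<open>\<bar>w\<bar>\<close>: \<open>q * \<alpha> + P * \<beta> = r\<close>. The upper bound on
    \<open>\<tau>\<close> makes it nonnegative.\<close>
  define \<beta> where "\<beta> = (r - q * \<alpha>) / P"
  have \<gamma>: "\<gamma> > 0" using r d by (simp add: \<gamma>_def)
  have \<alpha>: "\<alpha> \<ge> 0" using \<tau> \<gamma> by (simp add: \<alpha>_def)
  have psi: "psi P q r \<tau> = 1 / \<gamma>" by (simp add: psi_def \<gamma>_def d_def)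
  have "q * (\<tau> * (P - r)) \<le> r * d"
  proof -
    have "r * d - q * (\<tau> * (P - r)) = P * (r - \<tau> * (q - r))" by (simp add: d_def algebra_simps)
    moreover have "\<dots> \<ge> 0" using \<tau>' r by (intro mult_nonneg_nonneg) auto
    ultimately show ?thesis by linarith
  qed
  then have "q * \<alpha> \<le> r" using d by (simp add: \<alpha>_def \<gamma>_def divide_le_eq)
  then have \<beta>: "\<beta> \<ge> 0" using r by (simp add: \<beta>_def)
  have qP: "q * \<alpha> + P * \<beta> = r" using r by (simp add: \<beta>_def)
  have "P * (\<alpha> + \<beta> + \<gamma>) = (q * \<alpha> + P * \<beta>) + \<gamma> * d" by (simp add: \<alpha>_def d_def algebra_simps)
  also have "\<dots> = P * 1" using d unfolding qP by (simp add: \<gamma>_def)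
  finally have sum1: "\<alpha> + \<beta> + \<gamma> = 1" using r by (simp only: mult_cancel_left) auto
  \<comment> \<open>Chosen so that the powers of \<open>\<eta>\<close> cancel:
    \<open>C powr \<gamma> = \<eta> powr (- \<alpha> - \<beta>)\<close>.\<close>
  define C where "C = \<eta> powr (- ((\<alpha> + \<beta>) / \<gamma>))"
  show ?thesis
  proof (rule that)
    show "C > 0" using \<eta> by (simp add: C_def)
    fix w k v :: real assume kv: "k > 0" "v > 0"
    show "\<bar>w\<bar> powr r * k \<le> \<eta> * (\<bar>w\<bar> powr q * v) + \<eta> * \<bar>w\<bar> powr P + C * (k powr psi P q r \<tau> * v powr (- \<tau>))"
    proof (cases "w = 0")
      case True
      then show ?thesis using \<open>C > 0\<close> by simp
    next
      case False
      define X where "X = \<eta> * (\<bar>w\<bar> powr q * v)"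
      define Y where "Y = \<eta> * \<bar>w\<bar> powr P"
      define Z where "Z = C * (k powr (1 / \<gamma>) * v powr (- \<tau>))"
      have XYZ: "X > 0" "Y > 0" "Z > 0"
        using kv \<eta> False \<open>C > 0\<close> by (simp_all add: X_def Y_def Z_def)
      have X: "X powr \<alpha> = \<eta> powr \<alpha> * \<bar>w\<bar> powr (q * \<alpha>) * v powr \<alpha>"
        by (simp add: X_def powr_mult powr_powr)
      have Y: "Y powr \<beta> = \<eta> powr \<beta> * \<bar>w\<bar> powr (P * \<beta>)"
        by (simp add: Y_def powr_mult powr_powr)
      have Z: "Z powr \<gamma> = \<eta> powr (- \<alpha> - \<beta>) * k * v powr (- \<alpha>)"
        using \<gamma> kv by (simp add: Z_def C_def \<alpha>_def powr_mult powr_powr)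
      have "X powr \<alpha> * Y powr \<beta> * Z powr \<gamma> =
        (\<eta> powr \<alpha> * \<eta> powr \<beta> * \<eta> powr (- \<alpha> - \<beta>)) * (\<bar>w\<bar> powr (q * \<alpha>) * \<bar>w\<bar> powr (P * \<beta>)) *
        (v powr \<alpha> * v powr (- \<alpha>)) * k"
        unfolding X Y Z by (simp only: mult_ac)
      also have "\<dots> = \<bar>w\<bar> powr r * k"
        using \<eta> kv by (simp add: powr_add[symmetric] qP)
      finally have "\<bar>w\<bar> powr r * k = X powr \<alpha> * Y powr \<beta> * Z powr \<gamma>" by simp
      \<comment> \<open>A crude form of weighted AM-GM: each base is at most the sum, and the
        exponents add up to 1.\<close>
      also have "\<dots> \<le> (X + Y + Z) powr \<alpha> * (X + Y + Z) powr \<beta> * (X + Y + Z) powr \<gamma>"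
        using XYZ \<alpha> \<beta> \<gamma> by (intro mult_mono powr_mono2) auto
      also have "\<dots> = X + Y + Z"
        using XYZ sum1 by (simp add: powr_add[symmetric])
      finally show ?thesis by (simp add: X_def Y_def Z_def psi)
    qed
  qed
qed

text \<open>The case \<open>\<eta> = 1\<close>, integrated; it yields the boundedness of the
  embedding. What matters is that \<open>c\<close> is the same for all \<open>w\<close>.\<close>

lemma pow_integral_interpolation_bounded:
  fixes K V :: "'a::euclidean_space \<Rightarrow> real" and P q r \<tau> :: real
  assumes r: "1 \<le> r" "r < P" "r < q" and \<tau>: "0 \<le> \<tau>" "\<tau> \<le> r / (q - r)"
    and meas [measurable]: "K \<in> borel_measurable lebesgue" "V \<in> borel_measurable lebesgue"
    and pos: "\<And>x. K x > 0" "\<And>x. V x > 0"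
    and int: "integrable lebesgue (\<lambda>x. K x powr psi P q r \<tau> * V x powr (- \<tau>))"
  obtains c where "c > 0"
    "\<And>w. w \<in> borel_measurable lebesgue \<Longrightarrow> pow_integral lebesgue V q w \<le> ennreal A \<Longrightarrow>
       pow_integral lebesgue (\<lambda>_. 1) P w \<le> ennreal A \<Longrightarrow> pow_integral lebesgue K r w \<le> ennreal c"
proof -
  define H where "H x = K x powr psi P q r \<tau> * V x powr (- \<tau>)" for x
  have H0: "H x \<ge> 0" and V0: "V x \<ge> 0" for x using pos(2)[of x] by (simp_all add: H_def)
  have [measurable]: "H \<in> borel_measurable lebesgue" unfolding H_def by measurable
  obtain h where h: "(\<integral>\<^sup>+x. ennreal (H x) \<partial>lebesgue) = ennreal h" "h \<ge> 0"
    using int H0 nn_integral_eq_integral[of lebesgue H] integral_nonneg_AE[of H lebesgue]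
    unfolding H_def[symmetric] by auto
  obtain C where C: "C > 0" and interp: "\<And>w k v. k > 0 \<Longrightarrow> v > 0 \<Longrightarrow>
      \<bar>w\<bar> powr r * k \<le> 1 * (\<bar>w\<bar> powr q * v) + 1 * \<bar>w\<bar> powr P + C * (k powr psi P q r \<tau> * v powr (- \<tau>))"
    using weight_interpolation[OF r \<tau>, of 1] by (metis zero_less_one)
  \<comment> \<open>No sign is assumed for \<open>A\<close>; \<open>ennreal\<close> sends negative
    reals to 0, so \<open>max A 0\<close> gives the same bound.\<close>
  define B where "B = max A 0"
  show ?thesis
  proof (rule that)
    show "B + B + C * h + 1 > 0" using C h by (simp add: B_def add_nonneg_pos)
    fix w :: "'a \<Rightarrow> real"
    assume [measurable]: "w \<in> borel_measurable lebesgue" and "pow_integral lebesgue V q w \<le> ennreal A"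
      "pow_integral lebesgue (\<lambda>_. 1) P w \<le> ennreal A"
    then have w: "pow_integral lebesgue V q w \<le> ennreal B" "pow_integral lebesgue (\<lambda>_. 1) P w \<le> ennreal B"
      by (auto simp: B_def intro: order_trans ennreal_leI)
    have "pow_integral lebesgue K r w \<le>
      (\<integral>\<^sup>+x. ennreal (\<bar>w x\<bar> powr q * V x) + ennreal (\<bar>w x\<bar> powr P * 1) + ennreal C * ennreal (H x) \<partial>lebesgue)"
      unfolding pow_integral_def
    proof (rule nn_integral_mono)
      fix x
      show "ennreal (\<bar>w x\<bar> powr r * K x) \<le>
        ennreal (\<bar>w x\<bar> powr q * V x) + ennreal (\<bar>w x\<bar> powr P * 1) + ennreal C * ennreal (H x)"
        using interp[OF pos(1)[of x] pos(2)[of x], of "w x"] C H0[of x] V0[of x]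
        by (simp add: H_def ennreal_mult[symmetric] ennreal_plus[symmetric] ennreal_leI del: ennreal_plus)
    qed
    also have "\<dots> = pow_integral lebesgue V q w + pow_integral lebesgue (\<lambda>_. 1) P w + ennreal C * ennreal h"
      unfolding pow_integral_def h(1)[symmetric] by (simp add: nn_integral_add nn_integral_cmult)
    also have "\<dots> \<le> ennreal B + ennreal B + ennreal C * ennreal h" by (intro add_mono w order_refl)
    also have "\<dots> = ennreal (B + B + C * h)"
      using C h by (simp add: B_def ennreal_mult[symmetric] ennreal_plus[symmetric] del: ennreal_plus)
    also have "\<dots> \<le> ennreal (B + B + C * h + 1)" by (intro ennreal_leI) simp
    finally show "pow_integral lebesgue K r w \<le> ennreal (B + B + C * h + 1)" .
  qed
qed

text \<open>
  By the interpolation bound, \<open>\<bar>w\<bar> powr r * K\<close> is small in mean outside a set on which the weights are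
  bounded, and there convergence in measure suffices.
\<close>

lemma pow_integral_small_of_measure_small:
  fixes K V :: "'a::euclidean_space \<Rightarrow> real" and P q r \<tau> :: real
  assumes r: "1 \<le> r" "r < P" "r < q" and \<tau>: "0 \<le> \<tau>" "\<tau> \<le> r / (q - r)"
    and meas [measurable]: "K \<in> borel_measurable lebesgue" "V \<in> borel_measurable lebesgue"
    and pos: "\<And>x. K x > 0" "\<And>x. V x > 0"
    and int: "integrable lebesgue (\<lambda>x. K x powr psi P q r \<tau> * V x powr (- \<tau>))"
    and A: "A \<ge> 0" and e: "e > 0"
  obtains R \<delta> e' where "\<delta> > 0" "e' > 0"
    "\<And>w. w \<in> borel_measurable lebesgue \<Longrightarrow> pow_integral lebesgue V q w \<le> ennreal A \<Longrightarrow>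
       pow_integral lebesgue (\<lambda>_. 1) P w \<le> ennreal A \<Longrightarrow>
       emeasure lebesgue {x \<in> ball 0 R. \<bar>w x\<bar> > \<delta>} \<le> ennreal e' \<Longrightarrow>
       pow_integral lebesgue K r w \<le> ennreal e"
proof -
  define H where "H x = K x powr psi P q r \<tau> * V x powr (- \<tau>)" for x
  have [measurable]: "H \<in> borel_measurable lebesgue" unfolding H_def by measurable
  have H0: "H x \<ge> 0" for x by (simp add: H_def)
  have K0: "K x \<ge> 0" and V0: "V x \<ge> 0" for x using pos[of x] by auto
  have H_fin: "(\<integral>\<^sup>+x. ennreal (H x) \<partial>lebesgue) < \<infinity>"
    using int H0 unfolding H_def[symmetric] by (simp add: integrable_iff_bounded)
  \<comment> \<open>The error \<open>e\<close> is split into four quarters; this choice keeps the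
    two energy terms together within the first.\<close>
  define \<eta> where "\<eta> = e / (4 * (2 * A + 1))"
  have \<eta>: "\<eta> > 0" using e A by (simp add: \<eta>_def add_nonneg_pos)
  have "\<eta> * (2 * A + 1) = e / 4" using A unfolding \<eta>_def by (subst times_divide_eq_left, subst nonzero_divide_eq_eq) auto
  then have \<eta>A: "\<eta> * A + \<eta> * A \<le> e / 4" using \<eta> by (simp add: algebra_simps)
  obtain C where C: "C > 0" and interp: "\<And>w k v. k > 0 \<Longrightarrow> v > 0 \<Longrightarrow>
      \<bar>w\<bar> powr r * k \<le> \<eta> * (\<bar>w\<bar> powr q * v) + \<eta> * \<bar>w\<bar> powr P + C * (k powr psi P q r \<tau> * v powr (- \<tau>))"
    using weight_interpolation[OF r \<tau> \<eta>] by metis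
  \<comment> \<open>These sets exhaust the space because \<open>K\<close> and \<open>H\<close> are
    finite everywhere, so the integral of \<open>H\<close> over the complements tends to 0.\<close>
  define S where "S j = {x \<in> ball (0::'a) (real j). K x \<le> real j \<and> H x \<le> real j}" for j :: nat
  have [measurable]: "ball (0::'a) R \<in> sets lebesgue" for R by simp
  have S_meas [measurable]: "S j \<in> sets lebesgue" for j
  proof -
    have "{x \<in> space lebesgue. x \<in> ball (0::'a) (real j) \<and> K x \<le> real j \<and> H x \<le> real j} \<in> sets lebesgue"
      by measurable
    then show ?thesis by (simp add: S_def)
  qed
  have "(\<lambda>j. \<integral>\<^sup>+x. ennreal (H x) * indicator (- S j) x \<partial>lebesgue) \<longlonglongrightarrow> (\<integral>\<^sup>+x. 0 \<partial>(lebesgue :: 'a measure))"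
  proof (rule nn_integral_dominated_convergence[OF _ _ _ _ H_fin])
    show "AE x in lebesgue. (\<lambda>j. ennreal (H x) * indicator (- S j) x) \<longlonglongrightarrow> 0"
    proof (rule AE_I2)
      fix x :: 'a
      obtain J where J: "max (norm x + 1) (max (K x) (H x)) \<le> real J" using real_arch_simple by blast
      have "\<forall>\<^sub>F j in sequentially. ennreal (H x) * indicator (- S j) x = 0"
        using eventually_ge_at_top[of J]
      proof eventually_elim
        case (elim j)
        then have "real J \<le> real j" by simp
        with J have "x \<in> S j" by (auto simp: S_def)
        then show ?case by simp
      qed
      then show "(\<lambda>j. ennreal (H x) * indicator (- S j) x) \<longlonglongrightarrow> 0" by (rule tendsto_eventually)
    qed
  qed (auto simp: indicator_def)
  then have "\<forall>\<^sub>F j in sequentially. (\<integral>\<^sup>+x. ennreal (H x) * indicator (- S j) x \<partial>lebesgue) < ennreal (e / (4 * C))"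
    using e C by (intro order_tendstoD) auto
  then obtain j where j: "(\<integral>\<^sup>+x. ennreal (H x) * indicator (- S j) x \<partial>lebesgue) < ennreal (e / (4 * C))"
    by (auto simp: eventually_sequentially)
  define b where "b = measure lebesgue (ball (0::'a) (real j))"
  have b: "emeasure lebesgue (ball (0::'a) (real j)) = ennreal b"
    unfolding b_def using emeasure_lborel_ball_finite[of "0::'a" "real j"]
    by (intro emeasure_eq_ennreal_measure) auto
  have b0: "b \<ge> 0" by (simp add: b_def)
  \<comment> \<open>\<open>\<delta>\<close> and, further down, \<open>e'\<close> spend the last two
    quarters: one for the part of \<open>S j\<close> where
    \<open>\<bar>w x\<bar> \<le> \<delta>\<close>, the other for the part of the ball where
    \<open>\<bar>w x\<bar> > \<delta>\<close>.\<close>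
  define \<delta> where "\<delta> = (e / (4 * (real j * b + 1))) powr (1 / r)"
  have jb: "real j * b + 1 > 0" using b0 by (simp add: add_nonneg_pos)
  have \<delta>: "\<delta> > 0" "\<delta> powr r * real j * b \<le> e / 4"
  proof -
    show "\<delta> > 0" using e jb by (simp add: \<delta>_def)
    have "\<delta> powr r = e / (4 * (real j * b + 1))" using e jb r by (simp add: \<delta>_def powr_powr)
    then have "4 * (\<delta> powr r * real j * b) + 4 * \<delta> powr r = e" using jb by (simp add: field_simps)
    then show "\<delta> powr r * real j * b \<le> e / 4" using powr_ge_zero[of \<delta> r] by linarith
  qed
  define e' where "e' = e / (4 * (C * real j + 1))"
  have Cj: "C * real j + 1 > 0" using C by (simp add: add_nonneg_pos)
  have e': "e' > 0" "C * real j * e' \<le> e / 4"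
    using e Cj by (simp_all add: e'_def field_simps)
  show ?thesis
  proof (rule that[OF \<delta>(1) e'(1), of "real j"])
    fix w :: "'a \<Rightarrow> real"
    assume w [measurable]: "w \<in> borel_measurable lebesgue" and wq: "pow_integral lebesgue V q w \<le> ennreal A"
      and wP: "pow_integral lebesgue (\<lambda>_. 1) P w \<le> ennreal A"
      and small: "emeasure lebesgue {x \<in> ball 0 (real j). \<bar>w x\<bar> > \<delta>} \<le> ennreal e'"
    define T where "T = {x \<in> ball 0 (real j). \<bar>w x\<bar> > \<delta>}"
    have [measurable]: "T \<in> sets lebesgue"
    proof -
      have "{x \<in> space lebesgue. x \<in> ball (0::'a) (real j) \<and> \<bar>w x\<bar> > \<delta>} \<in> sets lebesgue"
        by measurable
      then show ?thesis by (simp add: T_def)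
    qed
    \<comment> \<open>Outside \<open>S j\<close> the interpolation bound keeps \<open>H\<close>; on
      \<open>S j\<close> it is used only where \<open>\<bar>w x\<bar> > \<delta>\<close>, with
      \<open>H\<close> at most \<open>j\<close>; elsewhere the integrand is at most
      \<open>\<delta> powr r * real j\<close>.\<close>
    have pt: "\<bar>w x\<bar> powr r * K x \<le> \<eta> * (\<bar>w x\<bar> powr q * V x) + \<eta> * (\<bar>w x\<bar> powr P * 1) +
      C * (H x * indicator (- S j) x) + C * real j * indicator T x + \<delta> powr r * real j * indicator (ball 0 (real j)) x" for x
    proof -
      have n: "\<eta> * (\<bar>w x\<bar> powr q * V x) \<ge> 0" "\<eta> * (\<bar>w x\<bar> powr P * 1) \<ge> 0"
        "C * (H x * indicator (- S j) x) \<ge> 0" "C * real j * indicator T x \<ge> 0"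
        "\<delta> powr r * real j * indicator (ball 0 (real j)) x \<ge> 0"
        using \<eta> V0[of x] C H0[of x] by simp_all
      have i: "\<bar>w x\<bar> powr r * K x \<le> \<eta> * (\<bar>w x\<bar> powr q * V x) + \<eta> * \<bar>w x\<bar> powr P + C * H x"
        unfolding H_def by (rule interp[OF pos])
      consider "x \<notin> S j" | "x \<in> S j" "\<bar>w x\<bar> > \<delta>" | "x \<in> S j" "\<bar>w x\<bar> \<le> \<delta>" by linarith
      then show ?thesis
      proof cases
        case 1
        then have "C * (H x * indicator (- S j) x) = C * H x" by simp
        then show ?thesis using i n by linarith
      next
        case 2
        then have "C * H x \<le> C * real j" using C by (simp add: S_def)
        moreover have "x \<in> T" using 2 by (auto simp: T_def S_def)
        then have "C * real j * indicator T x = C * real j" by simp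
        ultimately show ?thesis using i n by linarith
      next
        case 3
        then have "\<bar>w x\<bar> powr r * K x \<le> \<delta> powr r * real j"
          using r K0[of x] by (intro mult_mono powr_mono2) (auto simp: S_def)
        moreover have "x \<in> ball 0 (real j)" using 3 by (auto simp: S_def)
        then have "\<delta> powr r * real j * indicator (ball 0 (real j)) x = \<delta> powr r * real j" by simp
        ultimately show ?thesis using n by linarith
      qed
    qed
    have "pow_integral lebesgue K r w \<le> (\<integral>\<^sup>+x. ennreal \<eta> * ennreal (\<bar>w x\<bar> powr q * V x) + ennreal \<eta> * ennreal (\<bar>w x\<bar> powr P * 1) +
      ennreal C * (ennreal (H x) * indicator (- S j) x) + ennreal (C * real j) * indicator T x +
      ennreal (\<delta> powr r * real j) * indicator (ball 0 (real j)) x \<partial>lebesgue)"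
      unfolding pow_integral_def
    proof (rule nn_integral_mono)
      fix x
      have eq: "indicator X x = ennreal (indicator X x)" for X :: "'a set" by (simp add: indicator_def)
      show "ennreal (\<bar>w x\<bar> powr r * K x) \<le> ennreal \<eta> * ennreal (\<bar>w x\<bar> powr q * V x) + ennreal \<eta> * ennreal (\<bar>w x\<bar> powr P * 1) +
        ennreal C * (ennreal (H x) * indicator (- S j) x) + ennreal (C * real j) * indicator T x +
        ennreal (\<delta> powr r * real j) * indicator (ball 0 (real j)) x"
        unfolding eq using pt[of x] \<eta> C H0[of x] V0[of x]
        by (simp add: ennreal_mult[symmetric] ennreal_plus[symmetric] ennreal_leI del: ennreal_plus)
    qed
    also have "\<dots> = ennreal \<eta> * pow_integral lebesgue V q w + ennreal \<eta> * pow_integral lebesgue (\<lambda>_. 1) P w +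
      ennreal C * (\<integral>\<^sup>+x. ennreal (H x) * indicator (- S j) x \<partial>lebesgue) + ennreal (C * real j) * emeasure lebesgue T +
      ennreal (\<delta> powr r * real j) * emeasure lebesgue (ball (0::'a) (real j))"
      unfolding pow_integral_def by (simp add: nn_integral_add nn_integral_cmult nn_integral_cmult_indicator)
    also have "\<dots> \<le> ennreal \<eta> * ennreal A + ennreal \<eta> * ennreal A + ennreal C * ennreal (e / (4 * C)) +
      ennreal (C * real j) * ennreal e' + ennreal (\<delta> powr r * real j) * ennreal b"
      using wq wP j small b by (intro add_mono mult_left_mono) (auto simp: T_def)
    also have "\<dots> = ennreal (\<eta> * A + \<eta> * A + C * (e / (4 * C)) + C * real j * e' + \<delta> powr r * real j * b)"
      using \<eta> A C e e' \<delta> b0 by (simp add: ennreal_mult[symmetric] ennreal_plus[symmetric] del: ennreal_plus)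
    also have "\<dots> \<le> ennreal e"
      using \<eta>A e'(2) \<delta>(2) C by (intro ennreal_leI) (simp add: field_simps)
    finally show "pow_integral lebesgue K r w \<le> ennreal e" .
  qed
qed


section \<open>The compact embedding\<close>

text \<open>The Riesz-Fischer argument: a fast subsequence converges a.e., and Fatou turns the
  Cauchy condition into convergence of the whole sequence. The integrals of the \<open>U k\<close>
  themselves may be infinite; only those of differences enter.\<close>

lemma pow_integral_complete:
  fixes U :: "nat \<Rightarrow> 'b \<Rightarrow> real"
  assumes [measurable]: "\<And>k. U k \<in> borel_measurable M" "W \<in> borel_measurable M"
    and W: "\<And>x. W x > 0" and r: "r > 0"
    and cauchy: "\<And>e. e > 0 \<Longrightarrow> \<exists>n. \<forall>k\<ge>n. \<forall>m\<ge>n. pow_integral M W r (\<lambda>x. U k x - U m x) \<le> ennreal e"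
  obtains v where "v \<in> borel_measurable M" "(\<lambda>k. pow_integral M W r (\<lambda>x. U k x - v x)) \<longlonglongrightarrow> 0"
proof -
  have W0: "W x \<ge> 0" for x using W[of x] by simp
  \<comment> \<open>Scaled so that \<open>2 ^ j * D j x\<close> has integral at most
    \<open>(1/2) ^ j\<close>; summability then forces
    \<open>\<bar>D j x\<bar> \<le> (1/2) ^ j\<close> eventually, for a.e. \<open>x\<close>.\<close>
  define \<epsilon> where "\<epsilon> j = (1/2) ^ j / (2 ^ j) powr r" for j :: nat
  have \<epsilon>: "\<epsilon> j > 0" for j by (simp add: \<epsilon>_def)
  obtain n where n: "\<And>j k m. k \<ge> n j \<Longrightarrow> m \<ge> n j \<Longrightarrow> pow_integral M W r (\<lambda>x. U k x - U m x) \<le> ennreal (\<epsilon> j)"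
    using cauchy[OF \<epsilon>] by metis
  \<comment> \<open>Partial sums make the consecutive indices \<open>\<phi> j\<close> and
    \<open>\<phi> (Suc j)\<close> both pass \<open>n j\<close>; the added \<open>j\<close> sends
    \<open>\<phi>\<close> to infinity.\<close>
  define \<phi> where "\<phi> j = (\<Sum>i\<le>j. n i) + j" for j
  have \<phi>: "\<phi> j \<ge> n j" "\<phi> (Suc j) \<ge> n j" "\<phi> j \<ge> j" for j
    using member_le_sum[of j "{..j}" n] by (auto simp: \<phi>_def)
  define D where "D j x = U (\<phi> (Suc j)) x - U (\<phi> j) x" for j x
  have [measurable]: "D j \<in> borel_measurable M" for j unfolding D_def by measurable
  have D: "pow_integral M W r (\<lambda>x. 2 ^ j * D j x) \<le> ennreal ((1/2) ^ j)" for j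
  proof -
    have "pow_integral M W r (\<lambda>x. 2 ^ j * D j x) = ennreal (\<bar>2 ^ j\<bar> powr r) * pow_integral M W r (D j)"
      by (rule pow_integral_scale) (auto simp: W0)
    also have "\<dots> \<le> ennreal (\<bar>2 ^ j\<bar> powr r) * ennreal (\<epsilon> j)"
      unfolding D_def by (intro mult_left_mono n \<phi>) auto
    also have "\<dots> = ennreal ((1/2) ^ j)" using \<epsilon>[of j] by (simp add: ennreal_mult[symmetric] \<epsilon>_def)
    finally show ?thesis .
  qed
  have "(\<integral>\<^sup>+x. (\<Sum>j. ennreal (\<bar>2 ^ j * D j x\<bar> powr r * W x)) \<partial>M) = (\<Sum>j. pow_integral M W r (\<lambda>x. 2 ^ j * D j x))"
    unfolding pow_integral_def by (rule nn_integral_suminf) measurable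
  also have "\<dots> \<le> (\<Sum>j. ennreal ((1/2) ^ j))" by (intro suminf_le D) auto
  also have "\<dots> = ennreal (\<Sum>j. (1/2) ^ j)" by (intro suminf_ennreal2) auto
  also have "\<dots> < \<infinity>" by simp
  finally have "AE x in M. (\<Sum>j. ennreal (\<bar>2 ^ j * D j x\<bar> powr r * W x)) \<noteq> \<infinity>"
    by (intro nn_integral_noteq_infinite) auto
  then have conv: "AE x in M. convergent (\<lambda>j. U (\<phi> j) x)"
  proof eventually_elim
    case (elim x)
    then have "summable (\<lambda>j. \<bar>2 ^ j * D j x\<bar> powr r * W x)"
      using W0 by (intro summable_suminf_not_top) auto
    then have "(\<lambda>j. \<bar>2 ^ j * D j x\<bar> powr r * W x) \<longlonglongrightarrow> 0" by (rule summable_LIMSEQ_zero)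
    \<comment> \<open>The threshold \<open>W x\<close> lets the weight cancel and leaves a bound by
      1.\<close>
    then have "\<forall>\<^sub>F j in sequentially. \<bar>2 ^ j * D j x\<bar> powr r * W x < W x"
      using W[of x] by (intro order_tendstoD) auto
    then have "\<forall>\<^sub>F j in sequentially. norm (U (\<phi> (Suc j)) x - U (\<phi> j) x) \<le> (1/2) ^ j"
    proof eventually_elim
      case (elim j)
      have "\<bar>2 ^ j * D j x\<bar> \<le> 1"
      proof (rule ccontr)
        assume "\<not> ?thesis"
        then have "\<bar>2 ^ j * D j x\<bar> powr r \<ge> 1" using r by (intro ge_one_powr_ge_zero) auto
        then show False using elim mult_right_mono[OF _ W0[of x], of 1 "\<bar>2 ^ j * D j x\<bar> powr r"] by simp
      qed
      then have "2 ^ j * \<bar>D j x\<bar> \<le> 1" by (simp add: abs_mult)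
      then show ?case by (simp add: D_def field_simps power_divide)
    qed
    then have "summable (\<lambda>j. U (\<phi> (Suc j)) x - U (\<phi> j) x)"
      by (rule summable_comparison_test_ev) simp
    then have "convergent (\<lambda>j. U (\<phi> j) x - U (\<phi> 0) x)"
      unfolding summable_iff_convergent using sum_lessThan_telescope[of "\<lambda>j. U (\<phi> j) x"] by simp
    then show ?case by (simp add: convergent_diff_const_right_iff)
  qed
  define v where "v x = lim (\<lambda>j. U (\<phi> j) x)" for x
  have v [measurable]: "v \<in> borel_measurable M"
    unfolding v_def by (intro borel_measurable_lim_metric) measurable
  have ae: "AE x in M. (\<lambda>j. U (\<phi> j) x) \<longlonglongrightarrow> v x"
    using conv by eventually_elim (simp add: v_def convergent_LIMSEQ_iff)
  have "(\<lambda>k. pow_integral M W r (\<lambda>x. U k x - v x)) \<longlonglongrightarrow> 0"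
  proof (rule order_tendstoI)
    fix a :: ennreal assume "0 < a"
    then obtain b where b: "0 < b" "b < a" using dense by blast
    then obtain e where "b = ennreal e" "e \<ge> 0" by (cases b) auto
    with b have e: "e > 0" "ennreal e < a" by auto
    obtain n where n: "\<forall>k\<ge>n. \<forall>m\<ge>n. pow_integral M W r (\<lambda>x. U k x - U m x) \<le> ennreal e"
      using cauchy[OF e(1)] by blast
    have "pow_integral M W r (\<lambda>x. U k x - v x) < a" if k: "k \<ge> n" for k
    proof -
      have "\<forall>\<^sub>F j in sequentially. pow_integral M W r (\<lambda>x. U k x - U (\<phi> j) x) \<le> ennreal e"
        using eventually_ge_at_top[of n] by eventually_elim (use n k \<phi>(3) le_trans in blast)
      then have "pow_integral M W r (\<lambda>x. U k x - v x) \<le> ennreal e"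
        by (intro pow_integral_Fatou[where F = "\<lambda>j. U (\<phi> j)"] ae r) auto
      then show ?thesis using e(2) by (rule le_less_trans)
    qed
    then show "\<forall>\<^sub>F k in sequentially. pow_integral M W r (\<lambda>x. U k x - v x) < a"
      by (auto simp: eventually_sequentially)
  qed simp
  then show ?thesis by (rule that[OF v])
qed

theorem theorem7:
  fixes p q r s :: real and K V :: "real ^ 'n \<Rightarrow> real"
  assumes "CARD('n) \<ge> 2"
    and "1 \<le> p" and "0 < s" and "s < 1" and "s * p < real CARD('n)"
    and "1 \<le> r" and "r < min (crit_exp CARD('n) s p) q"
    and "K \<in> borel_measurable lebesgue" and "\<And>x. K x > 0"
    and "V \<in> borel_measurable lebesgue" and "\<And>x. V x > 0"
    and "\<And>D. compact D \<Longrightarrow> D \<noteq> {} \<Longrightarrow> (INF x\<in>D. V x) > 0"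
    and "\<exists>t :: ereal. t > ereal (max (crit_exp CARD('n) s p) q / (max (crit_exp CARD('n) s p) q - r)) \<and>
           K \<in> L_loc t"
    and "\<exists>\<tau>\<in>{0..r / (q - r)}.
           integrable lebesgue (\<lambda>x. K x powr psi (crit_exp CARD('n) s p) q r \<tau> * V x powr (- \<tau>))"
  shows "compact_embedding (MV_space s q p V) (MV_norm s q p V) (Lw r K) (Lw_norm r K)"
proof -
  define P where "P = crit_exp CARD('n) s p"
  note p = assms(2) and s = assms(3,5) and K [measurable] = assms(8) and V = assms(10,11)
  have r: "1 \<le> r" "r < P" "r < q" using assms(6,7) by (auto simp: P_def)
  have q: "1 \<le> q" using r by simp
  have K0: "K x \<ge> 0" for x using assms(9)[of x] by simp
  obtain \<tau> where \<tau>: "0 \<le> \<tau>" "\<tau> \<le> r / (q - r)"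
    and int: "integrable lebesgue (\<lambda>x. K x powr psi P q r \<tau> * V x powr (- \<tau>))"
    using assms(14) by (auto simp: P_def)
  note small = pow_integral_small_of_measure_small[OF r \<tau> K V(1) assms(9) V(2) int]
  let ?C = "sobolev_const CARD('n) s p powr (P / p)"

  \<comment> \<open>Bounds uniform on norm balls\<close>
  have bounds: "pow_integral lebesgue V q u \<le> ennreal (M powr q)"
    "pow_integral lebesgue (\<lambda>_. 1) P u \<le> ennreal ((?C * (M + 1)) powr P)"
    "gagliardo_integral s p u \<le> ennreal (M powr p)" "u \<in> borel_measurable lebesgue"
    if u: "u \<in> MV_space s q p V" "MV_norm s q p V u \<le> M" for u M
  proof -
    have uf: "u \<in> MV_fin s q p V" using u by (simp add: MV_space_def)
    show "pow_integral lebesgue V q u \<le> ennreal (M powr q)" "gagliardo_integral s p u \<le> ennreal (M powr p)"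
      by (rule MV_norm_le_bounds[OF uf p q u(2)])+
    show "pow_integral lebesgue (\<lambda>_. 1) P u \<le> ennreal ((?C * (M + 1)) powr P)"
      using MV_space_sobolev[OF p q _ _ V u] s by (simp add: P_def)
    show "u \<in> borel_measurable lebesgue" using uf by (simp add: MV_fin_def Lw_def)
  qed
  have small': "\<exists>R \<delta> e'. \<delta> > 0 \<and> e' > 0 \<and> (\<forall>w\<in>MV_space s q p V. MV_norm s q p V w \<le> M \<longrightarrow>
      emeasure lebesgue {x \<in> ball 0 R. \<bar>w x\<bar> > \<delta>} \<le> ennreal e' \<longrightarrow> pow_integral lebesgue K r w \<le> ennreal e)"
    if e: "e > 0" for M e
  proof -
    let ?A = "max (M powr q) ((?C * (M + 1)) powr P)"
    have A: "?A \<ge> 0" by (simp add: le_max_iff_disj)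
    show ?thesis
    proof (rule small[OF A e])
      fix R \<delta> e'
      assume R: "\<delta> > 0" "e' > 0"
        "\<And>w. w \<in> borel_measurable lebesgue \<Longrightarrow> pow_integral lebesgue V q w \<le> ennreal ?A \<Longrightarrow>
         pow_integral lebesgue (\<lambda>_. 1) P w \<le> ennreal ?A \<Longrightarrow>
         emeasure lebesgue {x \<in> ball 0 R. \<bar>w x\<bar> > \<delta>} \<le> ennreal e' \<Longrightarrow>
         pow_integral lebesgue K r w \<le> ennreal e"
      have "pow_integral lebesgue K r w \<le> ennreal e"
        if "w \<in> MV_space s q p V" "MV_norm s q p V w \<le> M" "emeasure lebesgue {x \<in> ball 0 R. \<bar>w x\<bar> > \<delta>} \<le> ennreal e'" for w
        by (intro R(3) bounds(4)[OF that(1,2)] that(3) order_trans[OF bounds(1)[OF that(1,2)]]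
            order_trans[OF bounds(2)[OF that(1,2)]] ennreal_leI max.cobounded1 max.cobounded2)
      then show ?thesis using R(1,2) by blast
    qed
  qed

  \<comment> \<open>Boundedness of the embedding\<close>
  obtain c where c: "c > 0" "\<And>u. u \<in> MV_space s q p V \<Longrightarrow> MV_norm s q p V u \<le> 1 \<Longrightarrow> pow_integral lebesgue K r u \<le> ennreal c"
  proof -
    let ?A = "max (1 powr q) ((?C * (1 + 1)) powr P)"
    show ?thesis
    proof (rule pow_integral_interpolation_bounded[OF r \<tau> K V(1) assms(9) V(2) int, where A = ?A])
      fix c
      assume c: "c > 0"
        "\<And>w. w \<in> borel_measurable lebesgue \<Longrightarrow> pow_integral lebesgue V q w \<le> ennreal ?A \<Longrightarrow>
         pow_integral lebesgue (\<lambda>_. 1) P w \<le> ennreal ?A \<Longrightarrow> pow_integral lebesgue K r w \<le> ennreal c"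
      have "pow_integral lebesgue K r u \<le> ennreal c" if "u \<in> MV_space s q p V" "MV_norm s q p V u \<le> 1" for u
        by (intro c(2) bounds(4)[OF that] order_trans[OF bounds(1)[OF that]]
            order_trans[OF bounds(2)[OF that]] ennreal_leI max.cobounded1 max.cobounded2)
      then show ?thesis using c(1) that by blast
    qed
  qed
  have embed: "u \<in> Lw r K \<and> Lw_norm r K u \<le> c powr (1 / r) * MV_norm s q p V u" if u: "u \<in> MV_space s q p V" for u
  proof -
    have uf: "u \<in> MV_fin s q p V" using u by (simp add: MV_space_def)
    have um [measurable]: "u \<in> borel_measurable lebesgue" using uf by (simp add: MV_fin_def Lw_def)
    \<comment> \<open>The bound \<open>c\<close> holds on the unit ball only, since interpolation
      mixes different powers of \<open>u\<close>; rescaling by the norm restores homogeneity. With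
      norm 0 no rescaling is possible, but then \<open>u\<close> vanishes a.e.\<close>
    have "pow_integral lebesgue K r u \<le> ennreal (c * MV_norm s q p V u powr r)"
    proof (cases "MV_norm s q p V u = 0")
      case True
      then have "AE x in lebesgue. u x = 0" using MV_norm_eq_0_iff[OF p q V uf] by simp
      then have "pow_integral lebesgue K r u = (\<integral>\<^sup>+x. 0 \<partial>(lebesgue :: (real ^ 'n) measure))"
        unfolding pow_integral_def by (intro nn_integral_cong_AE) (auto elim: eventually_mono)
      then show ?thesis by simp
    next
      case False
      define N where "N = MV_norm s q p V u"
      have N: "N > 0" using False MV_norm_nonneg[OF p q V, of s u] by (simp add: N_def)
      have "(\<lambda>x. (1 / N) * u x) \<in> MV_space s q p V" by (rule MV_space_scale[OF p q V u])
      moreover have "MV_norm s q p V (\<lambda>x. (1 / N) * u x) \<le> 1"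
        using N MV_norm_scale(2)[OF p q V uf, of "1 / N"] by (simp add: N_def)
      ultimately have "pow_integral lebesgue K r (\<lambda>x. (1 / N) * u x) \<le> ennreal c" by (rule c)
      then have "ennreal (N powr r) * pow_integral lebesgue K r (\<lambda>x. (1 / N) * u x) \<le> ennreal (N powr r) * ennreal c"
        by (intro mult_left_mono) auto
      moreover have "pow_integral lebesgue K r (\<lambda>x. N * ((1 / N) * u x)) =
        ennreal (\<bar>N\<bar> powr r) * pow_integral lebesgue K r (\<lambda>x. (1 / N) * u x)"
        by (rule pow_integral_scale) (auto simp: K0)
      ultimately show ?thesis
        using N c(1) by (simp add: N_def[symmetric] ennreal_mult[symmetric] mult.commute)
    qed
    moreover from this have fin: "pow_integral lebesgue K r u < \<infinity>" by (auto intro: le_less_trans)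
    moreover have "(c powr (1 / r) * MV_norm s q p V u) powr r = c * MV_norm s q p V u powr r"
      using c(1) r by (simp add: powr_mult powr_powr)
    ultimately show ?thesis
      using enn2real_powr_le_iff[OF fin, of r "c powr (1 / r) * MV_norm s q p V u"] r MV_norm_nonneg[OF p q V, of s u]
      by (simp add: Lw_def Lw_norm_def)
  qed

  \<comment> \<open>Extraction of a convergent subsequence\<close>
  have conv: "\<exists>\<phi> :: nat \<Rightarrow> nat. \<exists>v\<in>Lw r K. strict_mono \<phi> \<and> (\<lambda>k. Lw_norm r K (\<lambda>x. U (\<phi> k) x - v x)) \<longlonglongrightarrow> 0"
    if U: "\<And>k. U k \<in> MV_space s q p V" and bd: "bounded (range (\<lambda>k. MV_norm s q p V (U k)))" for U :: "nat \<Rightarrow> real ^ 'n \<Rightarrow> real"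
  proof -
    obtain M where M: "M > 0" "\<And>k. MV_norm s q p V (U k) \<le> M"
      using bd by (auto simp: bounded_pos abs_le_iff)
    note bnd = bounds[OF U M(2)]
    note Um [measurable] = bnd(4)
    have Uf: "U k \<in> MV_fin s q p V" for k using U[of k] by (simp add: MV_space_def)
    have N: "?C * (M + 1) > 0" using sobolev_const_pos[of "CARD('n)" s p] M(1) by simp
    have P: "1 \<le> P" using r by simp
    from gagliardo_bounded_Cauchy_in_measure[where U = U, OF Um p s(1) P N powr_ge_zero bnd(2,3)]
    obtain \<phi> :: "nat \<Rightarrow> nat" where \<phi>: "strict_mono \<phi>"
      and meas: "\<forall>R. \<forall>\<delta>>0. \<forall>e>0. \<exists>n. \<forall>k\<ge>n. \<forall>m\<ge>n.
       emeasure lebesgue {x \<in> ball 0 R. \<bar>U (\<phi> k) x - U (\<phi> m) x\<bar> > \<delta>} \<le> ennreal e"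
      by (elim exE conjE)
    \<comment> \<open>Differences stay in the space with norm at most \<open>2 * M\<close>, so one
      choice of \<open>R\<close>, \<open>\<delta>\<close> and \<open>e'\<close> from
      \<open>small'\<close> serves all of them.\<close>
    have diff: "(\<lambda>x. U k x - U m x) \<in> MV_space s q p V \<and> MV_norm s q p V (\<lambda>x. U k x - U m x) \<le> 2 * M" for k m
    proof
      show "(\<lambda>x. U k x - U m x) \<in> MV_space s q p V"
        using MV_space_add[OF p q V U[of k] MV_space_scale[OF p q V U[of m], of "-1"]] by simp
      show "MV_norm s q p V (\<lambda>x. U k x - U m x) \<le> 2 * M"
        using MV_norm_triangle[OF p q V Uf[of k] MV_fin_minus[OF p q V Uf[of m]]] M(2)[of k] M(2)[of m]
          MV_norm_minus[OF p q V Uf[of m]] by simp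
    qed
    have cauchy: "\<exists>n. \<forall>k\<ge>n. \<forall>m\<ge>n. pow_integral lebesgue K r (\<lambda>x. U (\<phi> k) x - U (\<phi> m) x) \<le> ennreal e" if "e > 0" for e
    proof -
      from small'[OF that, of "2 * M"] obtain R \<delta> e' where R: "\<delta> > 0" "e' > 0" "\<forall>w\<in>MV_space s q p V. MV_norm s q p V w \<le> 2 * M \<longrightarrow>
        emeasure lebesgue {x \<in> ball 0 R. \<bar>w x\<bar> > \<delta>} \<le> ennreal e' \<longrightarrow> pow_integral lebesgue K r w \<le> ennreal e"
        by (elim exE conjE)
      obtain n where "\<forall>k\<ge>n. \<forall>m\<ge>n. emeasure lebesgue {x \<in> ball 0 R. \<bar>U (\<phi> k) x - U (\<phi> m) x\<bar> > \<delta>} \<le> ennreal e'"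
        using meas R(1,2) by blast
      then show ?thesis using R(3) diff by (intro exI[of _ n]) simp
    qed
    have "0 < r" using r by simp
    then obtain v where v [measurable]: "v \<in> borel_measurable lebesgue"
      and lim: "(\<lambda>k. pow_integral lebesgue K r (\<lambda>x. U (\<phi> k) x - v x)) \<longlonglongrightarrow> 0"
      by (rule pow_integral_complete[where U = "\<lambda>k. U (\<phi> k)", OF Um K assms(9) _ cauchy])
    have "(\<lambda>k. enn2real (pow_integral lebesgue K r (\<lambda>x. U (\<phi> k) x - v x)) powr (1 / r)) \<longlonglongrightarrow> 0 powr (1 / r)"
      using r lim by (intro tendsto_powr' tendsto_enn2real tendsto_const) auto
    then have lim': "(\<lambda>k. Lw_norm r K (\<lambda>x. U (\<phi> k) x - v x)) \<longlonglongrightarrow> 0" by (simp add: Lw_norm_def)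
    \<comment> \<open>A single index at finite distance from \<open>v\<close> suffices to place
      \<open>v\<close> in \<open>Lw r K\<close>, by writing \<open>v\<close> as a sum.\<close>
    have "\<forall>\<^sub>F k in sequentially. pow_integral lebesgue K r (\<lambda>x. U (\<phi> k) x - v x) < \<infinity>"
      using lim by (rule order_tendstoD) simp
    then obtain k where k: "pow_integral lebesgue K r (\<lambda>x. U (\<phi> k) x - v x) < \<infinity>"
      by (auto simp: eventually_sequentially)
    have "pow_integral lebesgue K r (U (\<phi> k)) < \<infinity>" using embed[OF U[of "\<phi> k"]] by (simp add: Lw_def)
    then have "pow_integral lebesgue K r (\<lambda>x. (v x - U (\<phi> k) x) + U (\<phi> k) x) < \<infinity>"
      using k by (intro pow_integral_add_finite) (auto simp: K0 r pow_integral_minus_commute[of _ _ _ v])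
    then have "v \<in> Lw r K" by (simp add: Lw_def)
    then show ?thesis using \<phi> lim' by blast
  qed
  show ?thesis
    unfolding compact_embedding_def
  proof (intro conjI allI impI)
    show "MV_space s q p V \<subseteq> Lw r K" using embed by blast
    show "\<exists>C. \<forall>u\<in>MV_space s q p V. Lw_norm r K u \<le> C * MV_norm s q p V u" using embed by blast
  qed (use conv in blast)
qed

end
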